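(* Let $$s_3=\limsup_{x\to\infty}\frac{|W_3(x)|}{x^{\log_2 3}}.$$ Then $s_3=0.813\pm 0.158<1$; that is, $|s_3-0.813|\leq 0.158$, and in particular $s_3<1$.
   Context: For a positive integer $n$, $\Omega(n)$ denotes the number of prime factors of $n$ counted with multiplicity. For real $x$, $W_3(x)=\sum_{n\leq x}(-3)^{\Omega(n)}$, the sum running over positive integers $n\le x$. Here $\log_2 3=\log 3/\log 2$. *)

theory Defs
  imports Complex_Main "HOL-Library.Extended_Real" "HOL-Computational_Algebra.Primes"
begin

definition bigomega :: "nat \<Rightarrow> nat" where
  "bigomega n = size (prime_factorization n)"

definition W3 :: "real \<Rightarrow> int" where
  "W3 x = (\<Sum>n | 0 < n \<and> real n \<le> x. (- 3) ^ bigomega n)"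

text \<open>The limit superior is taken in the extended reals, so that it exists unconditionally.\<close>

definition s3 :: ereal where
  "s3 = Limsup at_top (\<lambda>x::real. ereal (\<bar>real_of_int (W3 x)\<bar> / x powr log 2 3))"

end

theory Submission
  imports Defs
begin

text \<open>
  Write \<open>alpha = log 2 3\<close>, and for a set \<open>P\<close> of primes let the smooth sum over \<open>P\<close> be the part of \<open>W3 x\<close>
  that comes from the numbers with all prime factors in \<open>P\<close>. Separating the multiples of a prime \<open>p\<close>
  gives the functional equation of \<open>smooth_sum_insert\<close>: the smooth sum over \<open>insert p P\<close> at \<open>x\<close> is that
  over \<open>P\<close> at \<open>x\<close>, minus three times that over \<open>insert p P\<close> at \<open>x / p\<close>. On the scale \<open>x powr alpha\<close>
  the substitution \<open>x / p\<close> costs the factor \<open>3 * p powr (- alpha) = (2 / p) powr alpha\<close>. This is \<open>1\<close> for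
  \<open>p = 2\<close> and summable over the odd primes. Hence the prime \<open>2\<close> alone determines the order of magnitude,
  and all other primes act as an absolutely convergent perturbation.

  For \<open>P = {2}\<close> the smooth sum is, up to a constant, the function \<open>wave\<close>, which changes by the factor
  \<open>-3\<close> when its argument is doubled. So \<open>W3 x\<close> is asymptotically a combination of terms
  \<open>g * wave (x / n)\<close> over odd \<open>n\<close>. A finite combination is determined by its restriction to one octave,
  where it is a step function with finitely many jumps, and its supremum relative to \<open>x powr alpha\<close> can
  be found by exact integer arithmetic (\<open>wave_sum_bound\<close>).

  The proof makes this effective. The functional equation is unfolded into a tree
  whose small branches are discarded at a known cost (\<open>dominated_expand\<close>). Bounds for the discarded
  branches come from the same procedure applied to fewer primes (\<open>valid_improve\<close>), or from a
  geometric series (\<open>valid_extend\<close>). For the primes below 200 this yields a step function whose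
  supremum is about \<open>0.8128\<close>, attained at the powers of \<open>2\<close>, with a discarded part of at most
  \<open>0.0701\<close> (\<open>certified_entries\<close>). The primes above \<open>199\<close> have total weight at most \<open>2/25\<close>, so they
  contribute at most \<open>2/23\<close> of the bound \<open>0.883\<close> (\<open>dominated_W3_diff\<close>). Therefore the limit superior is at most
  \<open>0.883 * 25/23 < 0.971\<close> and at least \<open>0.8127 - 0.0701 - 0.883 * 2/23 > 0.655\<close>.
\<close>

section \<open>Smooth sums and their functional equation\<close>

definition smooth_sum :: "nat set \<Rightarrow> real \<Rightarrow> real" where
  "smooth_sum P x = (\<Sum>n | 0 < n \<and> real n \<le> x \<and> prime_factors n \<subseteq> P. (- 3) ^ bigomega n)"

lemma finite_nat_le_real: "finite {n. 0 < n \<and> real n \<le> x \<and> R n}"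
proof (rule finite_subset)
  show "{n. 0 < n \<and> real n \<le> x \<and> R n} \<subseteq> {..nat \<lfloor>x\<rfloor>}"
    by (auto simp: le_nat_floor)
qed simp

lemma smooth_sum_eq_0: "x < 1 \<Longrightarrow> smooth_sum P x = 0"
proof -
  assume "x < 1"
  hence "{n. 0 < n \<and> real n \<le> x \<and> prime_factors n \<subseteq> P} = {}"
    by auto
  thus ?thesis unfolding smooth_sum_def by (simp only: sum.empty)
qed

lemma bigomega_prime_times:
  assumes "prime p" "m > 0" shows "bigomega (p * m) = Suc (bigomega m)"
  using assms by (simp add: bigomega_def prime_factorization_mult prime_factorization_prime)

lemma prime_factors_prime_times:
  fixes p m :: nat
  assumes "prime p" "m > 0" shows "prime_factors (p * m) = insert p (prime_factors m)"
  using assms by (simp add: prime_factorization_mult prime_factorization_prime)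

text \<open>
  Split the numbers according to divisibility by \<open>p\<close>. The multiples of \<open>p\<close> are \<open>p m\<close> with \<open>m\<close> again
  composed of the enlarged set of primes, and the factor \<open>p\<close> contributes \<open>-3\<close>.
\<close>

lemma smooth_sum_insert:
  assumes p: "prime p" "p \<notin> P"
  shows "smooth_sum (insert p P) x = smooth_sum P x - 3 * smooth_sum (insert p P) (x / real p)"
proof -
  let ?A = "\<lambda>P x. {n. 0 < n \<and> real n \<le> x \<and> prime_factors n \<subseteq> P}"
  have p0: "p > 0" using p(1) by (rule prime_gt_0_nat)
  have split: "?A (insert p P) x = ?A P x \<union> (\<lambda>m. p * m) ` ?A (insert p P) (x / real p)"
  proof (intro equalityI subsetI)
    fix n assume n: "n \<in> ?A (insert p P) x"
    show "n \<in> ?A P x \<union> (\<lambda>m. p * m) ` ?A (insert p P) (x / real p)"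
    proof (cases "p dvd n")
      case True
      then obtain m where m: "n = p * m" by blast
      with n have "m > 0" by auto
      have "real m \<le> x / real p" using n m p0 by (auto simp: field_simps)
      moreover have "prime_factors m \<subseteq> insert p P"
        using n m prime_factors_prime_times[OF p(1) \<open>m > 0\<close>] by auto
      ultimately show ?thesis using m \<open>m > 0\<close> by blast
    next
      case False
      hence "p \<notin> prime_factors n" by auto
      thus ?thesis using n by auto
    qed
  next
    fix n assume "n \<in> ?A P x \<union> (\<lambda>m. p * m) ` ?A (insert p P) (x / real p)"
    thus "n \<in> ?A (insert p P) x"
    proof
      assume "n \<in> (\<lambda>m. p * m) ` ?A (insert p P) (x / real p)"
      then obtain m where m: "m \<in> ?A (insert p P) (x / real p)" "n = p * m" by blast
      thus ?thesis using prime_factors_prime_times[OF p(1), of m] p0 by (auto simp: field_simps)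
    qed auto
  qed
  have disj: "?A P x \<inter> (\<lambda>m. p * m) ` ?A (insert p P) (x / real p) = {}"
  proof -
    have "p \<in> prime_factors (p * m)" if "m > 0" for m
      using prime_factors_prime_times[OF p(1) that] by simp
    thus ?thesis using p(2) by blast
  qed
  have inj: "inj_on (\<lambda>m. p * m) B" for B using p0 by (simp add: inj_on_def)
  have "smooth_sum (insert p P) x = smooth_sum P x + (\<Sum>n\<in>(\<lambda>m. p * m) ` ?A (insert p P) (x / real p). (- 3) ^ bigomega n)"
    unfolding smooth_sum_def split
    by (rule sum.union_disjoint) (use disj finite_nat_le_real in auto)
  also have "(\<Sum>n\<in>(\<lambda>m. p * m) ` ?A (insert p P) (x / real p). (- 3) ^ bigomega n)
      = (\<Sum>m\<in>?A (insert p P) (x / real p). (- 3 :: real) ^ bigomega (p * m))"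
    by (subst sum.reindex[OF inj]) simp
  also have "\<dots> = (\<Sum>m\<in>?A (insert p P) (x / real p). - 3 * (- 3) ^ bigomega m)"
    by (rule sum.cong) (use p(1) in \<open>auto simp: bigomega_prime_times\<close>)
  also have "\<dots> = - 3 * smooth_sum (insert p P) (x / real p)"
    unfolding smooth_sum_def by (simp add: sum_distrib_left)
  finally show ?thesis by simp
qed

lemma smooth_sum_empty: "x \<ge> 1 \<Longrightarrow> smooth_sum {} x = 1"
proof -
  assume "x \<ge> 1"
  hence "{n. 0 < n \<and> real n \<le> x \<and> prime_factors n \<subseteq> {}} = {1}"
    by (auto simp: prime_factorization_empty_iff)
  thus ?thesis unfolding smooth_sum_def by (simp add: bigomega_def)
qed

abbreviation alpha :: real where "alpha \<equiv> log 2 3"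

text \<open>
  \<open>19/12\<close> is a convergent of \<open>alpha\<close>, so close that replacing \<open>alpha\<close> by it enlarges the weight
  \<open>(2 / p) powr alpha\<close> of a prime below 200 by less than one percent. Powers with exponent \<open>19/12\<close> can be compared
  by integer arithmetic.
\<close>

lemma alpha_gt: "19 / 12 < alpha"
proof -
  have "(2 powr (19/12)) ^ 12 = (2::real) ^ 19"
    by (simp add: powr_powr flip: powr_numeral)
  hence "(2 powr (19/12)) ^ 12 < (3::real) ^ 12" by simp
  hence "2 powr (19/12) < (3::real)" by (rule power_less_imp_less_base) simp
  thus ?thesis by (subst less_log_iff) auto
qed

section \<open>The contribution of the prime 2\<close>

text \<open>
  The sum of \<open>(-3)^k\<close> over \<open>2^k \<le> x\<close> is \<open>wave x + 1/4\<close> for \<open>x \<ge> 1\<close>. Extended to all \<open>x > 0\<close>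
  without the constant, it becomes exactly self-similar under doubling.
\<close>

definition wave :: "real \<Rightarrow> real" where
  "wave x = 3 / 4 * (- 3) powi \<lfloor>log 2 x\<rfloor>"

lemma wave_double:
  assumes "x > 0" shows "wave (2 * x) = - 3 * wave x"
proof -
  have "\<lfloor>log 2 (2 * x)\<rfloor> = \<lfloor>log 2 x\<rfloor> + 1"
    using assms by (simp add: log_mult)
  thus ?thesis by (simp add: wave_def power_int_add)
qed

lemma wave_bound:
  assumes "x > 0" shows "\<bar>wave x\<bar> \<le> 3 / 4 * x powr alpha"
proof -
  have "(3::real) powi \<lfloor>log 2 x\<rfloor> = 3 powr of_int \<lfloor>log 2 x\<rfloor>"
    by (simp add: powr_real_of_int')
  also have "\<dots> \<le> 3 powr log 2 x" by (rule powr_mono) auto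
  also have "\<dots> = x powr alpha" using assms by (simp add: powr_def log_def)
  finally show ?thesis by (simp add: wave_def abs_mult power_int_abs)
qed

text \<open>
  For \<open>x < 1\<close> the smooth sum is \<open>0\<close> but \<open>wave x\<close> is not; it is then of size \<open>x powr alpha\<close>, which is below
  \<open>x powr (3/2)\<close>. For \<open>x \<ge> 1\<close> the difference is the constant \<open>1/4\<close>.
\<close>

lemma smooth_sum_2:
  assumes "x > 0"
  shows "\<bar>smooth_sum {2} x - wave x\<bar> \<le> 3/4 * x powr (3/2)"
proof -
  have exact: "x < 2 ^ k \<Longrightarrow> x \<ge> 1 \<Longrightarrow> smooth_sum {2} x = wave x + 1/4" for k :: nat and x :: real
  proof (induction k arbitrary: x)
    case (Suc k)
    have rec: "smooth_sum {2} x = 1 - 3 * smooth_sum {2} (x / 2)"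
      using smooth_sum_insert[of 2 "{}" x] Suc.prems by (simp add: smooth_sum_empty)
    show ?case
    proof (cases "x < 2")
      case True
      have "\<lfloor>log 2 x\<rfloor> = 0" using True Suc.prems by (simp add: floor_eq_iff less_log_iff log_less_iff)
      thus ?thesis using rec True by (simp add: smooth_sum_eq_0 wave_def)
    next
      case False
      have "smooth_sum {2} (x / 2) = wave (x / 2) + 1/4" using False Suc by auto
      moreover have "wave x = - 3 * wave (x / 2)" using wave_double[of "x/2"] False by simp
      ultimately show ?thesis using rec by simp
    qed
  qed simp
  show ?thesis
  proof (cases "x < 1")
    case True
    have "x powr alpha \<le> x powr (3/2)"
      using True assms alpha_gt by (intro powr_mono') auto
    thus ?thesis using wave_bound[OF assms] smooth_sum_eq_0[OF True] by simp
  next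
    case False
    obtain k where "x < 2 ^ k" using real_arch_pow[of 2 x] by auto
    moreover have "1 \<le> x powr (3/2)" using False by (simp add: ge_one_powr_ge_zero)
    ultimately show ?thesis using exact[of x k] False by simp
  qed
qed

section \<open>Sums over primes\<close>

text \<open>
  Both tangent bounds express convexity. The first yields a telescoping estimate for the tail of
  \<open>\<Sum> a powr (- s)\<close>; the second lets a step function be compared with \<open>x powr alpha\<close> by a linear test.
\<close>

lemma powr_neg_ge_tangent:
  fixes y r :: real
  assumes "y > 0" "r \<ge> 0" shows "1 + r * (1 - y) \<le> y powr (- r)"
proof -
  have "r * ln y \<le> r * (y - 1)" using assms ln_le_minus_one by (intro mult_left_mono) auto
  also have "1 - r * ln y \<le> exp (- r * ln y)" using exp_ge_add_one_self[of "- r * ln y"] by simp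
  ultimately show ?thesis using assms by (simp add: powr_def algebra_simps)
qed

lemma powr_ge_tangent:
  fixes x a :: real
  assumes "x \<ge> 1" "a \<ge> 1" shows "1 + a * (x - 1) \<le> x powr a"
proof -
  have "1 powr a - a * 1 \<le> x powr a - a * x"
  proof (rule DERIV_nonneg_imp_nondecreasing[OF assms(1)])
    fix t :: real assume t: "1 \<le> t" "t \<le> x"
    have "((\<lambda>t. t powr a - a * t) has_real_derivative a * t powr (a - 1) - a) (at t)"
      using t by (auto intro!: derivative_eq_intros)
    moreover have "1 \<le> t powr (a - 1)" using t assms by (intro ge_one_powr_ge_zero) auto
    hence "a * t powr (a - 1) - a \<ge> 0" using assms by (simp add: mult_le_cancel_left1)
    ultimately show "\<exists>y. ((\<lambda>t. t powr a - a * t) has_real_derivative y) (at t) \<and> 0 \<le> y" by blast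
  qed
  thus ?thesis by (simp add: algebra_simps)
qed

lemma sum_powr_tail:
  fixes s :: real
  assumes "s > 1" "A \<ge> 1" "A \<le> N"
  shows "(\<Sum>a = Suc A..N. real a powr (- s)) \<le> (real A powr (1 - s) - real N powr (1 - s)) / (s - 1)"
  using assms(3)
proof (induction N rule: dec_induct)
  case (step N)
  have N: "N \<ge> 1" using step assms by simp
  have "1 + (s - 1) * (1 - real N / (real N + 1)) \<le> (real N / (real N + 1)) powr (- (s - 1))"
    using N assms by (intro powr_neg_ge_tangent) auto
  hence "(1 + (s - 1) / (real N + 1)) * (real N + 1) powr (1 - s)
      \<le> (real N / (real N + 1)) powr (1 - s) * (real N + 1) powr (1 - s)"
    by (intro mult_right_mono) (auto simp: field_simps)
  also have "\<dots> = real N powr (1 - s)"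
    using N by (simp add: powr_mult flip: powr_mult)
  also have "(1 + (s - 1) / (real N + 1)) * (real N + 1) powr (1 - s)
      = (real N + 1) powr (1 - s) + (s - 1) * (real N + 1) powr (- s)"
    using powr_diff[of "real N + 1" "1 - s" 1] by (simp add: algebra_simps)
  finally have "(s - 1) * (real N + 1) powr (- s) \<le> real N powr (1 - s) - (real N + 1) powr (1 - s)"
    by simp
  hence "(real N + 1) powr (- s) \<le> (real N powr (1 - s) - (real N + 1) powr (1 - s)) / (s - 1)"
    using assms by (simp add: pos_le_divide_eq mult.commute)
  moreover have "(\<Sum>a = Suc A..Suc N. real a powr (- s)) = (\<Sum>a = Suc A..N. real a powr (- s)) + (real N + 1) powr (- s)"
    using step by (simp add: add.commute)
  ultimately show ?case using step.IH by (simp add: diff_divide_distrib add.commute)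
qed simp

lemma prime_mod_6:
  fixes q :: nat assumes "prime q" "q > 3" shows "q mod 6 = 1 \<or> q mod 6 = 5"
proof -
  have "\<not> 2 dvd q" "\<not> 3 dvd q"
    using assms primes_dvd_imp_eq[of 2 q] primes_dvd_imp_eq[of 3 q] by auto
  thus ?thesis by presburger
qed

text \<open>
  Primes above 3 are \<open>1\<close> or \<open>5\<close> modulo \<open>6\<close>, so each value of \<open>q div 6\<close> is taken at most twice. This
  crude sieve suffices and needs no information on the distribution of primes.
\<close>

lemma sum_prime_powr_tail:
  fixes s :: real
  assumes "s > 1" "A \<ge> 1" "finite Q" and Q: "\<And>q. q \<in> Q \<Longrightarrow> prime q \<and> q > 6 * A"
  shows "(\<Sum>q\<in>Q. real q powr (- s)) \<le> 2 * 6 powr (- s) * (real A powr (- s) + real A powr (1 - s) / (s - 1))"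
proof -
  define N where "N = Max (insert A ((\<lambda>q. q div 6) ` Q))"
  have NA: "A \<le> N" and NQ: "\<And>q. q \<in> Q \<Longrightarrow> q div 6 \<le> N" using assms(3) by (auto simp: N_def)
  define Z where "Z = (\<Sum>a = A..N. real a powr (- s))"
  have class_bound: "(\<Sum>q | q \<in> Q \<and> q mod 6 = r. real q powr (- s)) \<le> 6 powr (- s) * Z" for r
  proof -
    have "(\<Sum>q | q \<in> Q \<and> q mod 6 = r. real q powr (- s)) \<le> (\<Sum>q | q \<in> Q \<and> q mod 6 = r. (6 * real (q div 6)) powr (- s))"
    proof (rule sum_mono)
      fix q assume "q \<in> {q. q \<in> Q \<and> q mod 6 = r}"
      hence "q > 6 * A" using Q by auto
      hence "q div 6 > 0" using assms(2) by (simp add: div_greater_zero_iff)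
      moreover have "6 * real (q div 6) \<le> real q" by linarith
      ultimately show "real q powr (- s) \<le> (6 * real (q div 6)) powr (- s)"
        using assms(1) by (intro powr_mono2') auto
    qed
    also have "\<dots> = (\<Sum>a\<in>(\<lambda>q. q div 6) ` {q. q \<in> Q \<and> q mod 6 = r}. (6 * real a) powr (- s))"
    proof (rule sum.reindex_cong[symmetric])
      show "inj_on (\<lambda>q. q div 6) {q. q \<in> Q \<and> q mod 6 = r}"
        by (rule inj_onI) (metis (mono_tags, lifting) div_mult_mod_eq mem_Collect_eq)
    qed auto
    also have "\<dots> \<le> (\<Sum>a = A..N. (6 * real a) powr (- s))"
    proof (rule sum_mono2)
      have "A \<le> q div 6" if "q \<in> Q" for q using Q[OF that] by linarith
      thus "(\<lambda>q. q div 6) ` {q. q \<in> Q \<and> q mod 6 = r} \<subseteq> {A..N}" using NQ by auto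
    qed auto
    also have "\<dots> = 6 powr (- s) * Z"
      by (simp add: Z_def powr_mult sum_distrib_left)
    finally show ?thesis .
  qed
  have "Q = {q. q \<in> Q \<and> q mod 6 = 1} \<union> {q. q \<in> Q \<and> q mod 6 = 5}"
  proof -
    have "q mod 6 = 1 \<or> q mod 6 = 5" if "q \<in> Q" for q
      using Q[OF that] prime_mod_6[of q] assms(2) by auto
    thus ?thesis by blast
  qed
  hence "(\<Sum>q\<in>Q. real q powr (- s)) = (\<Sum>q\<in>{q. q \<in> Q \<and> q mod 6 = 1} \<union> {q. q \<in> Q \<and> q mod 6 = 5}. real q powr (- s))"
    by simp
  also have "\<dots> = (\<Sum>q | q \<in> Q \<and> q mod 6 = 1. real q powr (- s)) + (\<Sum>q | q \<in> Q \<and> q mod 6 = 5. real q powr (- s))"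
    using assms(3) by (intro sum.union_disjoint) auto
  also have "\<dots> \<le> 2 * 6 powr (- s) * Z"
    using class_bound[of 1] class_bound[of 5] by simp
  also have "Z \<le> real A powr (- s) + real A powr (1 - s) / (s - 1)"
  proof -
    have "Z = real A powr (- s) + (\<Sum>a = Suc A..N. real a powr (- s))"
      unfolding Z_def using NA by (simp add: sum.atLeast_Suc_atMost)
    also have "(\<Sum>a = Suc A..N. real a powr (- s)) \<le> (real A powr (1 - s) - real N powr (1 - s)) / (s - 1)"
      using assms NA by (intro sum_powr_tail) auto
    also have "\<dots> \<le> real A powr (1 - s) / (s - 1)"
      using assms by (intro divide_right_mono) auto
    finally show ?thesis by simp
  qed
  finally show ?thesis by (simp add: mult_left_mono)
qed

section \<open>Adjoining odd primes\<close>

lemma three_times_le: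
  fixes s K L y z y' z' :: real
  assumes "s \<le> K * y + L * z" "3 * y \<le> y'" "3 * z \<le> z'" "K \<ge> 0" "L \<ge> 0"
  shows "3 * s \<le> K * y' + L * z'"
proof -
  have "3 * s \<le> K * (3 * y) + L * (3 * z)" using assms(1) by simp
  also have "\<dots> \<le> K * y' + L * z'" using assms by (intro add_mono mult_left_mono)
  finally show ?thesis .
qed

text \<open>
  Iterating the functional equation gives a geometric series. Its ratio on the scale \<open>x powr alpha\<close> is
  \<open>3 * p powr (- alpha) = (2 / p) powr alpha\<close>, because \<open>2 powr alpha = 3\<close>: only the prime \<open>2\<close> is
  critical. The second term carries all lower-order contributions; its exponent \<open>3/2\<close> is chosen
  below \<open>alpha\<close>, yet large enough for \<open>3 * p powr (- 3/2) < 1\<close> to hold from \<open>p = 3\<close> on and to have a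
  convergent sum over the primes.
\<close>

lemma smooth_sum_insert_bound:
  assumes p: "prime p" "p \<notin> P"
    and G: "\<And>x. x > 0 \<Longrightarrow> \<bar>smooth_sum P x\<bar> \<le> c * x powr alpha + d * x powr (3/2)"
    and v: "(2 / real p) powr alpha \<le> v" "v < 1"
    and u: "3 * real p powr (- 3/2) \<le> u" "u < 1"
    and cd: "c \<ge> 0" "d \<ge> 0" and x: "x > 0"
  shows "\<bar>smooth_sum (insert p P) x\<bar> \<le> c / (1 - v) * x powr alpha + d / (1 - u) * x powr (3/2)"
proof -
  have p1: "real p > 1" using prime_gt_1_nat[OF p(1)] by simp
  \<comment> \<open>Induction on the number of divisions by \<open>p\<close> that lead below \<open>1\<close>, where the sum is empty.\<close>
  have main: "\<bar>smooth_sum (insert p P) x\<bar> \<le> c / (1 - v) * x powr alpha + d / (1 - u) * x powr (3/2)"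
    if "x < real p ^ k" "x > 0" for k x
    using that
  proof (induction k arbitrary: x)
    case 0
    thus ?case using cd v u by (simp add: smooth_sum_eq_0)
  next
    case (Suc k)
    have x: "x > 0" and xp: "x / real p > 0" using Suc.prems p1 by auto
    have "x / real p < real p ^ k" using Suc.prems p1 by (simp add: field_simps)
    from Suc.IH[OF this xp]
    have IH: "\<bar>smooth_sum (insert p P) (x / real p)\<bar>
        \<le> c / (1 - v) * (x / real p) powr alpha + d / (1 - u) * (x / real p) powr (3/2)" .
    have "3 * (x / real p) powr alpha = x powr alpha * (2 / real p) powr alpha"
      using x p1 by (simp add: powr_divide)
    also have "\<dots> \<le> x powr alpha * v" using v by (intro mult_left_mono) auto
    finally have y: "3 * (x / real p) powr alpha \<le> x powr alpha * v" .
    have "3 * (x / real p) powr (3/2) = x powr (3/2) * (3 * real p powr (- 3/2))"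
      using x p1 by (simp add: powr_divide powr_minus_divide)
    also have "\<dots> \<le> x powr (3/2) * u" using u by (intro mult_left_mono) auto
    finally have z: "3 * (x / real p) powr (3/2) \<le> x powr (3/2) * u" .
    have "3 * \<bar>smooth_sum (insert p P) (x / real p)\<bar>
        \<le> c / (1 - v) * (x powr alpha * v) + d / (1 - u) * (x powr (3/2) * u)"
      using cd v u by (intro three_times_le[OF IH y z] divide_nonneg_nonneg) auto
    moreover have "\<bar>smooth_sum (insert p P) x\<bar> \<le> \<bar>smooth_sum P x\<bar> + 3 * \<bar>smooth_sum (insert p P) (x / real p)\<bar>"
      using smooth_sum_insert[OF p, of x] by simp
    moreover have "c * x powr alpha + c / (1 - v) * (x powr alpha * v) = c / (1 - v) * x powr alpha"
      using v by (simp add: field_simps)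
    moreover have "d * x powr (3/2) + d / (1 - u) * (x powr (3/2) * u) = d / (1 - u) * x powr (3/2)"
      using u by (simp add: field_simps)
    ultimately show ?case using G[OF x] by linarith
  qed
  obtain k where "x < real p ^ k" using real_arch_pow[OF p1] by auto
  thus ?thesis using main x by blast
qed

lemma three_powr_minus_three_halves:
  assumes "p \<ge> 3" shows "3 * real p powr (- 3/2) < 1"
proof -
  have "real p powr (- 3/2) \<le> 3 powr (- 3/2)" using assms by (intro powr_mono2') auto
  also have "\<dots> < 3 powr (- 1)" by (intro powr_less_mono) auto
  also have "(3::real) powr (- 1) = 1 / 3" by (simp add: powr_minus_divide)
  finally show ?thesis by simp
qed

text \<open>
  Adding one prime of weight \<open>t\<close> to a set of total weight \<open>s\<close> multiplies the bound by \<open>1 / (1 - t)\<close>; since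
  \<open>(1 - s) * (1 - t) \<ge> 1 - (s + t)\<close>, the excess over the original bound stays below \<open>u / (1 - u)\<close> for the
  total weight \<open>u\<close>. Working with the sum of the weights avoids the product over the primes.
\<close>

lemma excess_step:
  fixes r s t y :: real
  assumes "r \<ge> 0" "s \<ge> 0" "t \<ge> 0" "t + s < 1" "y \<ge> 0"
  shows "r * (s / (1 - s)) * y + r / (1 - s) / (1 - t) * (t * y) \<le> r * ((t + s) / (1 - (t + s))) * y"
proof -
  have pos: "1 - s > 0" "1 - t > 0" "1 - (t + s) > 0" using assms by linarith+
  have "s / (1 - s) + t / ((1 - s) * (1 - t)) = (s * (1 - t) + t) / ((1 - s) * (1 - t))"
    using pos by (simp add: add_divide_distrib)
  also have "s * (1 - t) + t = 1 - (1 - s) * (1 - t)" by algebra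
  also have "(1 - (1 - s) * (1 - t)) / ((1 - s) * (1 - t)) = 1 / ((1 - s) * (1 - t)) - 1"
    using pos by (simp add: diff_divide_distrib)
  also have "\<dots> \<le> 1 / (1 - (t + s)) - 1"
  proof -
    have "1 - (t + s) \<le> (1 - s) * (1 - t)" using assms by (simp add: algebra_simps)
    thus ?thesis using pos by (intro diff_right_mono divide_left_mono mult_pos_pos) auto
  qed
  also have "\<dots> = (t + s) / (1 - (t + s))" using pos by (simp add: field_simps)
  finally have "(s / (1 - s) + t / ((1 - s) * (1 - t))) * (r * y) \<le> (t + s) / (1 - (t + s)) * (r * y)"
    using assms by (intro mult_right_mono) auto
  moreover have "r * (s / (1 - s)) * y + r / (1 - s) / (1 - t) * (t * y) = (s / (1 - s) + t / ((1 - s) * (1 - t))) * (r * y)"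
    by (simp only: distrib_right) (simp add: mult_ac)
  ultimately show ?thesis by (simp add: mult_ac)
qed

text \<open>
  The estimate depends on the added primes only through their total weight. It therefore holds uniformly
  for the primes up to \<open>x\<close>, a set that grows with the argument.
\<close>

lemma smooth_sum_union_bound:
  assumes "finite Q" and Q: "\<And>q. q \<in> Q \<Longrightarrow> prime q \<and> q \<notin> P"
    and G: "\<And>x. x > 0 \<Longrightarrow> \<bar>smooth_sum P x\<bar> \<le> c * x powr alpha + d * x powr (3/2)"
    and cd: "c \<ge> 0" "d \<ge> 0"
    and v: "(\<Sum>q\<in>Q. (2 / real q) powr alpha) < 1"
    and u: "(\<Sum>q\<in>Q. 3 * real q powr (- 3/2)) < 1"
    and x: "x > 0"
  defines "\<sigma> \<equiv> \<Sum>q\<in>Q. (2 / real q) powr alpha" and "\<tau> \<equiv> \<Sum>q\<in>Q. 3 * real q powr (- 3/2)"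
  shows "\<bar>smooth_sum (P \<union> Q) x - smooth_sum P x\<bar>
    \<le> c * (\<sigma> / (1 - \<sigma>)) * x powr alpha + d * (\<tau> / (1 - \<tau>)) * x powr (3/2)"
  using assms(1) Q v u x unfolding \<sigma>_def \<tau>_def
proof (induction Q arbitrary: x rule: finite_induct)
  case (insert q Q)
  define \<sigma> where "\<sigma> = (\<Sum>q\<in>Q. (2 / real q) powr alpha)"
  define \<tau> where "\<tau> = (\<Sum>q\<in>Q. 3 * real q powr (- 3/2))"
  define v where "v = (2 / real q) powr alpha"
  define u where "u = 3 * real q powr (- 3/2)"
  have q: "prime q" "q \<notin> P \<union> Q" using insert by auto
  have q1: "real q > 1" using prime_gt_1_nat[OF q(1)] by simp
  have sums: "(\<Sum>q\<in>insert q Q. (2 / real q) powr alpha) = v + \<sigma>"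
    "(\<Sum>q\<in>insert q Q. 3 * real q powr (- 3/2)) = u + \<tau>"
    using insert.hyps by (simp_all add: \<sigma>_def \<tau>_def v_def u_def)
  have nonneg: "\<sigma> \<ge> 0" "\<tau> \<ge> 0" "v \<ge> 0" "u \<ge> 0"
    by (auto simp: \<sigma>_def \<tau>_def u_def v_def intro!: sum_nonneg)
  have small: "v + \<sigma> < 1" "u + \<tau> < 1"
    using insert.prems(2,3) by (simp_all only: sums)
  have x: "x > 0" by (rule insert.prems(4))
  have lt1: "1 - \<sigma> \<ge> 0" "1 - \<tau> \<ge> 0" "1 - v \<ge> 0" "1 - u \<ge> 0" "v < 1" "u < 1" using small nonneg by linarith+
  have IH: "\<bar>smooth_sum (P \<union> Q) x - smooth_sum P x\<bar>
      \<le> c * (\<sigma> / (1 - \<sigma>)) * x powr alpha + d * (\<tau> / (1 - \<tau>)) * x powr (3/2)" if "x > 0" for x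
    using insert.IH[OF _ _ _ that] insert.prems(1) small nonneg
    unfolding \<sigma>_def[symmetric] \<tau>_def[symmetric] by simp
  have PQ: "\<bar>smooth_sum (P \<union> Q) x\<bar> \<le> c / (1 - \<sigma>) * x powr alpha + d / (1 - \<tau>) * x powr (3/2)"
    if "x > 0" for x
  proof -
    have "c / (1 - \<sigma>) = c + c * (\<sigma> / (1 - \<sigma>))" "d / (1 - \<tau>) = d + d * (\<tau> / (1 - \<tau>))"
      using small nonneg by (simp_all add: field_simps)
    hence "c / (1 - \<sigma>) * x powr alpha = c * x powr alpha + c * (\<sigma> / (1 - \<sigma>)) * x powr alpha"
      "d / (1 - \<tau>) * x powr (3/2) = d * x powr (3/2) + d * (\<tau> / (1 - \<tau>)) * x powr (3/2)"
      by (simp_all only: distrib_right)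
    thus ?thesis using IH[OF that] G[OF that] by linarith
  qed
  have xq: "x / real q > 0" using x q1 by simp
  have "\<bar>smooth_sum (insert q (P \<union> Q)) (x / real q)\<bar>
      \<le> c / (1 - \<sigma>) / (1 - v) * (x / real q) powr alpha + d / (1 - \<tau>) / (1 - u) * (x / real q) powr (3/2)"
    by (rule smooth_sum_insert_bound[OF q PQ _ lt1(5) _ lt1(6) _ _ xq])
       (simp_all only: u_def v_def order.refl divide_nonneg_nonneg cd lt1(1,2))
  moreover have "3 * (x / real q) powr alpha \<le> v * x powr alpha"
    using x q1 by (simp add: powr_divide v_def)
  moreover have "3 * (x / real q) powr (3/2) \<le> u * x powr (3/2)"
    using x q1 by (simp add: powr_divide powr_minus_divide u_def)
  ultimately have last: "3 * \<bar>smooth_sum (insert q (P \<union> Q)) (x / real q)\<bar>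
      \<le> c / (1 - \<sigma>) / (1 - v) * (v * x powr alpha) + d / (1 - \<tau>) / (1 - u) * (u * x powr (3/2))"
    using cd lt1 by (intro three_times_le[of _ _ "(x / real q) powr alpha" _ "(x / real q) powr (3/2)"] divide_nonneg_nonneg)
  have "\<bar>smooth_sum (P \<union> insert q Q) x - smooth_sum P x\<bar>
      \<le> \<bar>smooth_sum (P \<union> Q) x - smooth_sum P x\<bar> + 3 * \<bar>smooth_sum (insert q (P \<union> Q)) (x / real q)\<bar>"
    using smooth_sum_insert[OF q, of x] by simp
  also have "\<dots> \<le> c * ((v + \<sigma>) / (1 - (v + \<sigma>))) * x powr alpha + d * ((u + \<tau>) / (1 - (u + \<tau>))) * x powr (3/2)"
    using IH[OF insert.prems(4)] last
      excess_step[OF cd(1) nonneg(1,3) small(1), of "x powr alpha"] excess_step[OF cd(2) nonneg(2,4) small(2), of "x powr (3/2)"]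
    by simp
  finally show ?case by (simp only: sums)
next
  case empty
  show ?case by (simp only: sum.empty) simp
qed

section \<open>Domination up to lower order\<close>

text \<open>
  \<open>c\<close> bounds the size of \<open>F\<close> on the scale \<open>x powr alpha\<close>, up to a term that does not affect the limit
  superior.
\<close>

definition dominated :: "(real \<Rightarrow> real) \<Rightarrow> real \<Rightarrow> bool" where
  "dominated F c \<longleftrightarrow> (\<exists>d\<ge>0. \<forall>x>0. \<bar>F x\<bar> \<le> c * x powr alpha + d * x powr (3/2))"

lemma dominated_add:
  assumes "dominated F a" "dominated G b" shows "dominated (\<lambda>x. F x + G x) (a + b)"
proof -
  obtain d where d: "d \<ge> 0" "\<And>x. x > 0 \<Longrightarrow> \<bar>F x\<bar> \<le> a * x powr alpha + d * x powr (3/2)"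
    using assms(1) unfolding dominated_def by blast
  obtain e where e: "e \<ge> 0" "\<And>x. x > 0 \<Longrightarrow> \<bar>G x\<bar> \<le> b * x powr alpha + e * x powr (3/2)"
    using assms(2) unfolding dominated_def by blast
  have "\<bar>F x + G x\<bar> \<le> (a + b) * x powr alpha + (d + e) * x powr (3/2)" if "x > 0" for x
    using d(2)[OF that] e(2)[OF that] abs_triangle_ineq[of "F x" "G x"] by (simp add: distrib_right)
  thus ?thesis unfolding dominated_def using d(1) e(1) by (intro exI[of _ "d + e"]) auto
qed

lemma dominated_mono: "dominated F a \<Longrightarrow> a \<le> b \<Longrightarrow> dominated F b"
  unfolding dominated_def by (meson add_right_mono mult_right_mono order_trans powr_ge_zero)

lemma dominated_dilate:
  assumes F: "dominated F c" and n: "n > 0" and le: "\<bar>g\<bar> * n powr (- alpha) * c \<le> c'"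
  shows "dominated (\<lambda>x. g * F (x / n)) c'"
proof -
  obtain d where d: "d \<ge> 0" "\<And>x. x > 0 \<Longrightarrow> \<bar>F x\<bar> \<le> c * x powr alpha + d * x powr (3/2)"
    using F unfolding dominated_def by blast
  have "\<bar>g * F (x / n)\<bar> \<le> c' * x powr alpha + (\<bar>g\<bar> * n powr (- 3/2) * d) * x powr (3/2)" if x: "x > 0" for x
  proof -
    have "\<bar>g * F (x / n)\<bar> \<le> \<bar>g\<bar> * (c * (x / n) powr alpha + d * (x / n) powr (3/2))"
      unfolding abs_mult using d(2)[of "x / n"] x n by (intro mult_left_mono) auto
    also have "(x / n) powr alpha = n powr (- alpha) * x powr alpha"
      using x n by (simp add: powr_divide powr_minus_divide)
    also have "(x / n) powr (3/2) = n powr (- 3/2) * x powr (3/2)"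
      using x n by (simp add: powr_divide powr_minus_divide)
    also have "\<bar>g\<bar> * (c * (n powr (- alpha) * x powr alpha) + d * (n powr (- 3/2) * x powr (3/2)))
        = (\<bar>g\<bar> * n powr (- alpha) * c) * x powr alpha + (\<bar>g\<bar> * n powr (- 3/2) * d) * x powr (3/2)"
      by (simp only: distrib_left mult_ac)
    also have "\<dots> \<le> c' * x powr alpha + (\<bar>g\<bar> * n powr (- 3/2) * d) * x powr (3/2)"
      using le by (intro add_right_mono mult_right_mono) auto
    finally show ?thesis .
  qed
  thus ?thesis unfolding dominated_def
    by (intro exI[of _ "\<bar>g\<bar> * n powr (- 3/2) * d"] conjI allI impI) (use d(1) in auto)
qed

lemma powr_neg_eventually_less:
  fixes d \<epsilon> :: real
  assumes "\<epsilon> > 0" shows "eventually (\<lambda>x. d * x powr (3/2 - alpha) < \<epsilon>) at_top"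
proof -
  have "((\<lambda>x. d * x powr (3/2 - alpha)) \<longlongrightarrow> d * 0) at_top"
    using alpha_gt by (intro tendsto_mult tendsto_const tendsto_neg_powr filterlim_ident) auto
  thus ?thesis using assms by (intro order_tendstoD(2)) auto
qed

lemma dominated_nonneg:
  assumes "dominated F c" shows "c \<ge> 0"
proof (rule ccontr)
  assume "\<not> c \<ge> 0"
  obtain d where d: "d \<ge> 0" "\<And>x. x > 0 \<Longrightarrow> \<bar>F x\<bar> \<le> c * x powr alpha + d * x powr (3/2)"
    using assms unfolding dominated_def by blast
  have "eventually (\<lambda>x. d * x powr (3/2 - alpha) < - c) at_top"
    using \<open>\<not> c \<ge> 0\<close> by (intro powr_neg_eventually_less) auto
  then obtain x where x: "x > 0" "d * x powr (3/2 - alpha) < - c"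
    using eventually_conj[OF eventually_gt_at_top[of 0]] by (metis (mono_tags, lifting) eventually_happens' trivial_limit_at_top_linorder)
  have "d * x powr (3/2) = d * x powr (3/2 - alpha) * x powr alpha"
    by (simp flip: powr_add)
  also have "\<dots> < - c * x powr alpha" using x by (intro mult_strict_right_mono) auto
  finally show False using d(2)[OF x(1)] by simp
qed

section \<open>Expansion of a smooth sum into waves\<close>

text \<open>
  An entry \<open>(p, v, c)\<close> of a list holds a prime \<open>p\<close>, a weight \<open>v\<close> and a bound \<open>c\<close>, where \<open>v\<close> and \<open>c\<close> are
  real numbers multiplied by \<open>2^20\<close>. The weight bounds \<open>(2 / p) powr alpha\<close>, and \<open>c\<close> bounds the smooth
  sum over \<open>2\<close>, \<open>p\<close> and the primes of the later entries. A jump \<open>(m, g)\<close> stands for the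
  function \<open>g * wave (x / m)\<close>.
\<close>

type_synonym entry = "int \<times> int \<times> int"
type_synonym jump = "int \<times> int"

abbreviation base :: int where "base \<equiv> 16777216"

definition smooth_primes :: "entry list \<Rightarrow> nat set" where
  "smooth_primes ps = insert 2 ((\<lambda>e. nat (fst e)) ` set ps)"

lemma smooth_primes_simps [simp]:
  "smooth_primes [] = {2}" "smooth_primes ((p, v, c) # ps) = insert (nat p) (smooth_primes ps)"
  by (auto simp: smooth_primes_def)

fun valid :: "entry list \<Rightarrow> bool" where
  "valid [] = True"
| "valid ((p, v, c) # ps) \<longleftrightarrow> valid ps \<and> p > 2 \<and> prime (nat p) \<and> nat p \<notin> smooth_primes ps
     \<and> v < 2 ^ 20 \<and> (2 / p) powr alpha \<le> v / 2 ^ 20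
     \<and> dominated (smooth_sum (smooth_primes ((p, v, c) # ps))) (c / 2 ^ 20)"

text \<open>
  Replacing \<open>(m, g)\<close> by \<open>(2 m, -3 g)\<close> does not change the function that a jump stands for. Doubling
  moves every \<open>m\<close> into the octave from \<open>base\<close> to \<open>2 * base\<close> and keeps both components integral, where
  halving the argument would produce fractions. The octave starts at \<open>2 ^ 24\<close>, above every \<open>n\<close> that occurs.
\<close>

fun scale_up :: "nat \<Rightarrow> int \<Rightarrow> int \<Rightarrow> jump" where
  "scale_up 0 m g = (m, g)"
| "scale_up (Suc k) m g = (if m < base then scale_up k (2 * m) (- 3 * g) else (m, g))"

text \<open>
  The functional equation, applied repeatedly, writes \<open>g\<close> times the smooth sum at \<open>x / n\<close> as a tree. A
  branch whose whole contribution is known to be small (\<open>w\<close> bounds the size of \<open>g * (1 / n) powr alpha\<close>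
  and \<open>c\<close> that of the smooth sum) is discarded, and the bound \<open>w * c\<close> is added to the error; the other
  branches end in jumps. Weights have denominator \<open>2^20\<close> and are rounded up at each multiplication, errors
  have denominator \<open>2^40\<close>. The first argument limits the depth; when it is exhausted, the branch is
  discarded too, which is always sound.
\<close>

fun expand :: "nat \<Rightarrow> int \<Rightarrow> entry list \<Rightarrow> int \<Rightarrow> int \<Rightarrow> int \<Rightarrow> jump list \<times> int" where
  "expand k th [] n g w = ([scale_up 24 n g], 0)"
| "expand 0 th ((p, v, c) # ps) n g w = ([], w * c)"
| "expand (Suc k) th ((p, v, c) # ps) n g w =
     (if w * c \<le> th then ([], w * c)
      else case expand k th ((p, v, c) # ps) (n * p) (- 3 * g) (drop_bit 20 (w * v) + 1) of (A, a) \<Rightarrow>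
        case expand k th ps n g w of (B, b) \<Rightarrow> (A @ B, a + b))"

definition wave_sum :: "jump list \<Rightarrow> real \<Rightarrow> real" where
  "wave_sum A x = (\<Sum>(m, g)\<leftarrow>A. g * wave (x / m))"

lemma wave_sum_simps [simp]:
  "wave_sum [] x = 0"
  "wave_sum ((m, g) # A) x = g * wave (x / m) + wave_sum A x"
  "wave_sum (A @ B) x = wave_sum A x + wave_sum B x"
  by (simp_all add: wave_sum_def)

lemma wave_sum_scale_up:
  assumes "n > 0" "x > 0"
  shows "wave_sum [scale_up k n g] x = g * wave (x / n)"
  using assms
proof (induction k arbitrary: n g)
  case (Suc k)
  have "wave (x / of_int n) = - 3 * wave (x / of_int (2 * n))"
    using wave_double[of "x / of_int (2 * n)"] Suc.prems by simp
  thus ?case using Suc.IH[of "2 * n" "- 3 * g"] Suc.prems by simp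
qed simp

lemma dominated_pruned:
  assumes "valid ((p, v, c) # ps)" "n > 0" "\<bar>of_int g\<bar> * of_int n powr (- alpha) \<le> w / 2 ^ 20"
  shows "dominated (\<lambda>x. g * smooth_sum (smooth_primes ((p, v, c) # ps)) (x / n)) (w * c / 2 ^ 40)"
proof (rule dominated_dilate)
  show D: "dominated (smooth_sum (smooth_primes ((p, v, c) # ps))) (c / 2 ^ 20)"
    using assms(1) by (simp only: valid.simps)
  have "\<bar>of_int g\<bar> * of_int n powr (- alpha) * (c / 2 ^ 20) \<le> (w / 2 ^ 20) * (c / 2 ^ 20)"
    by (rule mult_right_mono[OF assms(3) dominated_nonneg[OF D]])
  thus "\<bar>of_int g\<bar> * of_int n powr (- alpha) * (c / 2 ^ 20) \<le> w * c / 2 ^ 40" by simp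
qed (use assms(2) in simp)

lemma dominated_expand:
  assumes "valid ps" "n > 0" "\<bar>of_int g\<bar> * of_int n powr (- alpha) \<le> w / 2 ^ 20" "expand k th ps n g w = (A, a)"
  shows "dominated (\<lambda>x. g * smooth_sum (smooth_primes ps) (x / n) - wave_sum A x) (a / 2 ^ 40)"
  using assms
proof (induction k th ps n g w arbitrary: A a rule: expand.induct)
  case (1 k th n g w)
  have "dominated (\<lambda>x. smooth_sum {2} x - wave x) 0"
    unfolding dominated_def by (intro exI[of _ "3/4"]) (use smooth_sum_2 in auto)
  hence "dominated (\<lambda>x. g * (smooth_sum {2} (x / n) - wave (x / n))) 0"
    using 1 by (intro dominated_dilate[where F = "\<lambda>x. smooth_sum {2} x - wave x" and c = 0]) auto
  then obtain d where d: "d \<ge> 0"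
    "\<And>x. x > 0 \<Longrightarrow> \<bar>g * (smooth_sum {2} (x / n) - wave (x / n))\<bar> \<le> 0 * x powr alpha + d * x powr (3/2)"
    unfolding dominated_def by blast
  have "\<bar>g * smooth_sum {2} (x / n) - wave_sum A x\<bar> \<le> 0 * x powr alpha + d * x powr (3/2)" if "x > 0" for x
    using d(2)[OF that] wave_sum_scale_up[OF 1(2) that, of 24 g] 1(4) by (simp only: expand.simps prod.inject right_diff_distrib)
  moreover have "a = 0" using 1(4) by simp
  ultimately show ?case unfolding dominated_def smooth_primes_simps
    by (intro exI[of _ d] conjI allI impI d(1)) simp
next
  case (2 th p v c ps n g w)
  have "A = []" "a = w * c" using 2(4) by simp_all
  thus ?case using dominated_pruned[OF 2(1-3)] by simp
next
  case (3 k th p v c ps n g w)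
  let ?P = "smooth_primes ((p, v, c) # ps)"
  show ?case
  proof (cases "w * c \<le> th")
    case True
    hence "A = []" "a = w * c" using 3(6) by simp_all
    thus ?thesis using dominated_pruned[OF 3(3-5)] by simp
  next
    case False
    obtain B b where B: "expand k th ((p, v, c) # ps) (n * p) (- 3 * g) (drop_bit 20 (w * v) + 1) = (B, b)"
      by (cases "expand k th ((p, v, c) # ps) (n * p) (- 3 * g) (drop_bit 20 (w * v) + 1)")
    obtain C c' where C: "expand k th ps n g w = (C, c')" by (cases "expand k th ps n g w")
    have A: "A = B @ C" "a = b + c'" using 3(6) by (simp_all only: expand.simps False if_False B C prod.case prod.inject simp_thms)
    have p: "p > 2" "prime (nat p)" "nat p \<notin> smooth_primes ps" "(2 / p) powr alpha \<le> v / 2 ^ 20"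
      using 3(3) by auto
    have "\<bar>of_int (- 3 * g)\<bar> * of_int (n * p) powr (- alpha)
        = (\<bar>of_int g\<bar> * of_int n powr (- alpha)) * (2 / p) powr alpha"
      using 3(4) p(1) by (simp add: abs_mult powr_mult powr_divide powr_minus_divide)
    also have "\<dots> \<le> (w / 2 ^ 20) * (v / 2 ^ 20)"
      by (rule mult_mono[OF 3(5) p(4) order_trans[OF _ 3(5)]]) simp_all
    also have "\<dots> \<le> of_int (drop_bit 20 (w * v) + 1) / 2 ^ 20"
    proof -
      have "w * v \<le> (drop_bit 20 (w * v) + 1) * 2 ^ 20"
      proof -
        have "t \<le> (t div 2 ^ 20 + 1) * 2 ^ 20" for t :: int by simp
        thus ?thesis by (simp only: drop_bit_eq_div)
      qed
      hence "real_of_int (w * v) \<le> real_of_int ((drop_bit 20 (w * v) + 1) * 2 ^ 20)" by (simp only: of_int_le_iff)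
      hence "real_of_int w * v / 2 ^ 40 \<le> real_of_int (drop_bit 20 (w * v) + 1) * 2 ^ 20 / 2 ^ 40"
        by (intro divide_right_mono) simp_all
      thus ?thesis by (simp add: mult.commute)
    qed
    \<comment> \<open>Rounding up keeps the weight an upper bound for the new factor.\<close>
    finally have w: "\<bar>of_int (- 3 * g)\<bar> * of_int (n * p) powr (- alpha) \<le> of_int (drop_bit 20 (w * v) + 1) / 2 ^ 20" .
    have "dominated (\<lambda>x. (of_int (- 3 * g) * smooth_sum ?P (x / of_int (n * p)) - wave_sum B x)
        + (g * smooth_sum (smooth_primes ps) (x / n) - wave_sum C x)) (b / 2 ^ 40 + c' / 2 ^ 40)"
    proof (rule dominated_add)
      show "dominated (\<lambda>x. of_int (- 3 * g) * smooth_sum ?P (x / of_int (n * p)) - wave_sum B x) (b / 2 ^ 40)"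
        using 3(1)[OF False 3(3) _ w B] 3(4) p(1) by simp
      show "dominated (\<lambda>x. g * smooth_sum (smooth_primes ps) (x / n) - wave_sum C x) (c' / 2 ^ 40)"
        using 3(2)[OF False B[symmetric] _ 3(4,5) C] 3(3) by simp
    qed
    also have "(\<lambda>x. (of_int (- 3 * g) * smooth_sum ?P (x / of_int (n * p)) - wave_sum B x)
        + (g * smooth_sum (smooth_primes ps) (x / n) - wave_sum C x))
      = (\<lambda>x. g * smooth_sum ?P (x / n) - wave_sum A x)"
    proof
      fix x :: real
      have eq: "smooth_sum ?P (x / n) = smooth_sum (smooth_primes ps) (x / n) - 3 * smooth_sum ?P (x / n / p)"
        using smooth_sum_insert[OF p(2,3), of "x / n"] p(1) by simp
      show "(of_int (- 3 * g) * smooth_sum ?P (x / of_int (n * p)) - wave_sum B x)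
          + (g * smooth_sum (smooth_primes ps) (x / n) - wave_sum C x) = g * smooth_sum ?P (x / n) - wave_sum A x"
        unfolding eq A wave_sum_simps by (simp only: of_int_mult of_int_minus of_int_numeral
          divide_divide_eq_left right_diff_distrib mult_minus_left mult.assoc mult.left_commute[of _ 3])
    qed
    finally show ?thesis by (simp add: A add_divide_distrib)
  qed
qed

section \<open>Sums of waves as step functions\<close>

text \<open>
  On one octave, a sum of waves is a step function: each wave equals \<open>-1/4\<close> before its jump and \<open>3/4\<close>
  after it. Four times the sum therefore starts at minus the sum \<open>T\<close> of all \<open>g\<close>, rises by \<open>4 * g\<close> at
  each jump, and ends at \<open>3 * T\<close>. The scan is given the claimed starting value \<open>z\<close>, and the final test
  \<open>a = - 3 * z\<close> verifies it without a separate summation. Four times the sum is compared with the line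
  \<open>K * (19 * m - 7 * base)\<close>, which is \<open>12 * K * base\<close> times the tangent \<open>1 + 19/12 * (m / base - 1)\<close>;
  since the line increases, testing it at the jumps is enough. The parameter \<open>l\<close> checks
  that the jumps are sorted.
\<close>

fun scan :: "int \<Rightarrow> int \<Rightarrow> int \<Rightarrow> int \<Rightarrow> jump list \<Rightarrow> bool" where
  "scan K z l a [] \<longleftrightarrow> a = - 3 * z"
| "scan K z l a ((m, g) # A) \<longleftrightarrow> (let a' = a + 4 * g in
     l \<le> m \<and> m < 2 * base \<and> \<bar>a'\<bar> \<le> K * (19 * m - 7 * base) \<and> scan K z m a' A)"

definition jump_sum :: "jump list \<Rightarrow> real \<Rightarrow> int" where
  "jump_sum A x = (\<Sum>(m, g)\<leftarrow>A. if real_of_int m \<le> x then g else 0)"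

lemma jump_sum_simps [simp]:
  "jump_sum [] x = 0"
  "jump_sum ((m, g) # A) x = (if real_of_int m \<le> x then g else 0) + jump_sum A x"
  by (simp_all add: jump_sum_def)

lemma jump_sum_eq_0:
  assumes "\<And>m g. (m, g) \<in> set A \<Longrightarrow> x < real_of_int m" shows "jump_sum A x = 0"
  using assms
proof (induction A)
  case (Cons e A)
  obtain m g where e: "e = (m, g)" by (cases e)
  have "x < real_of_int m" using Cons.prems[of m g] by (simp add: e)
  moreover have "jump_sum A x = 0" by (rule Cons.IH) (use Cons.prems in auto)
  ultimately show ?case by (simp add: e)
qed simp

lemma scan_range:
  assumes "scan K z l a A"
  shows "a + 4 * (\<Sum>(m, g)\<leftarrow>A. g) = - 3 * z" "\<And>m g. (m, g) \<in> set A \<Longrightarrow> l \<le> m \<and> m < 2 * base"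
proof -
  have "a + 4 * (\<Sum>(m, g)\<leftarrow>A. g) = - 3 * z \<and> (\<forall>e\<in>set A. l \<le> fst e \<and> fst e < 2 * base)"
    using assms
  proof (induction A arbitrary: l a)
    case (Cons e A)
    obtain m g where e: "e = (m, g)" by (cases e)
    have h: "l \<le> m" "m < 2 * base" "scan K z m (a + 4 * g) A"
      using Cons.prems by (auto simp: e Let_def)
    have IH: "a + 4 * g + 4 * (\<Sum>(m, g)\<leftarrow>A. g) = - 3 * z" "\<forall>e\<in>set A. m \<le> fst e \<and> fst e < 2 * base"
      using Cons.IH[OF h(3)] by auto
    have "a + 4 * (\<Sum>(m, g)\<leftarrow>e # A. g) = - 3 * z" using IH(1) by (simp add: e)
    moreover have "\<forall>e\<in>set A. l \<le> fst e \<and> fst e < 2 * base" using IH(2) h(1) by force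
    ultimately show ?case using h by (simp add: e)
  qed simp
  thus "a + 4 * (\<Sum>(m, g)\<leftarrow>A. g) = - 3 * z" "\<And>m g. (m, g) \<in> set A \<Longrightarrow> l \<le> m \<and> m < 2 * base"
    by auto
qed

lemma scan_bound:
  fixes x :: real
  assumes "scan K z l a A" "K \<ge> 0" "\<bar>real_of_int a\<bar> \<le> K * (19 * x - 7 * base)"
  shows "\<bar>real_of_int (a + 4 * jump_sum A x)\<bar> \<le> K * (19 * x - 7 * base)"
  using assms
proof (induction A arbitrary: l a)
  case (Cons e A)
  obtain m g where e: "e = (m, g)" by (cases e)
  have h: "\<bar>a + 4 * g\<bar> \<le> K * (19 * m - 7 * base)" "scan K z m (a + 4 * g) A"
    using Cons.prems(1) by (auto simp: e Let_def)
  show ?case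
  proof (cases "m \<le> x")
    case True
    have "real_of_int \<bar>a + 4 * g\<bar> \<le> real_of_int (K * (19 * m - 7 * base))"
      using h(1) by (simp only: of_int_le_iff)
    also have "\<dots> = K * (19 * real_of_int m - 7 * base)" by simp
    also have "\<dots> \<le> K * (19 * x - 7 * base)" using True Cons.prems(2) by (intro mult_left_mono) auto
    finally have "\<bar>real_of_int (a + 4 * g)\<bar> \<le> K * (19 * x - 7 * base)" by simp
    from Cons.IH[OF h(2) Cons.prems(2) this] show ?thesis using True by (simp add: e add.assoc)
  next
    case False
    have "jump_sum A x = 0"
    proof (rule jump_sum_eq_0)
      fix m' g' assume "(m', g') \<in> set A"
      hence "m \<le> m'" using scan_range(2)[OF h(2)] by blast
      thus "x < real_of_int m'" using False by linarith
    qed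
    thus ?thesis using False Cons.prems(3) by (simp add: e)
  qed
qed simp

lemma wave_eq:
  fixes x :: real
  assumes "base \<le> m" "m < 2 * base" "real_of_int base \<le> x" "x < real_of_int (2 * base)"
  shows "wave (x / real_of_int m) = (if m \<le> x then 3 / 4 else - 1 / 4)"
proof -
  have "\<lfloor>log 2 (x / real_of_int m)\<rfloor> = (if m \<le> x then 0 else - 1)"
  proof (cases "m \<le> x")
    case True
    have "1 \<le> x / m" "x / m < 2" using True assms by (auto simp: field_simps)
    thus ?thesis using True by (auto simp: floor_eq_iff log_less_iff)
  next
    case False
    have "1 / 2 \<le> x / m" "x / m < 1" "x / m > 0" using False assms by (auto simp: field_simps)
    thus ?thesis using False by (auto simp: floor_eq_iff log_less_iff le_log_iff powr_minus_divide)
  qed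
  thus ?thesis by (simp add: wave_def)
qed

text \<open>
  The first jump, at the start of the octave, is treated apart: only there is a lower bound \<open>l\<close> recorded,
  and the next jump must come strictly later, so that \<open>z + 4 * g\<close> is four times the value at \<open>base\<close>.
\<close>

fun wave_check :: "int \<Rightarrow> int \<Rightarrow> int \<Rightarrow> jump list \<Rightarrow> bool" where
  "wave_check K z l [] \<longleftrightarrow> False"
| "wave_check K z l ((m, g) # A) \<longleftrightarrow> m = base \<and> 0 \<le> l \<and> l \<le> z + 4 * g \<and> z + 4 * g \<le> 12 * base * K
     \<and> scan K z (base + 1) (z + 4 * g) A"

lemma wave_sum_eq:
  fixes x :: real
  assumes "\<And>m g. (m, g) \<in> set A \<Longrightarrow> base \<le> m \<and> m < 2 * base" and x: "real_of_int base \<le> x" "x < real_of_int (2 * base)"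
  shows "4 * wave_sum A x = real_of_int (4 * jump_sum A x - (\<Sum>(m, g)\<leftarrow>A. g))"
  using assms(1)
proof (induction A)
  case (Cons e A)
  obtain m g where e: "e = (m, g)" by (cases e)
  have m: "base \<le> m" "m < 2 * base" using Cons.prems[of m g] by (simp_all add: e)
  have IH: "4 * wave_sum A x = real_of_int (4 * jump_sum A x - (\<Sum>(m, g)\<leftarrow>A. g))"
    by (rule Cons.IH) (use Cons.prems in auto)
  show ?case using IH wave_eq[OF m x] by (auto simp: e)
qed simp

lemma wave_check_period:
  fixes x :: real
  assumes A: "wave_check K z l A" and x: "real_of_int base \<le> x" "x < real_of_int (2 * base)"
  shows "\<bar>4 * wave_sum A x\<bar> \<le> K * (19 * x - 7 * base)" "x = real_of_int base \<Longrightarrow> 4 * wave_sum A x \<ge> l"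
proof -
  obtain g B where B: "A = (base, g) # B" "0 \<le> l" "l \<le> z + 4 * g" "z + 4 * g \<le> 12 * base * K"
    "scan K z (base + 1) (z + 4 * g) B"
    using A by (cases "(K, z, l, A)" rule: wave_check.cases) auto
  have K: "K \<ge> 0" using B by linarith
  have "\<bar>real_of_int (z + 4 * g)\<bar> \<le> real_of_int (12 * base * K)" using B by linarith
  also have "\<dots> = K * (19 * real_of_int base - 7 * base)" by simp
  also have "\<dots> \<le> K * (19 * x - 7 * base)" using x K by (intro mult_left_mono) auto
  finally have start: "\<bar>real_of_int (z + 4 * g)\<bar> \<le> K * (19 * x - 7 * base)" .
  note S = scan_bound[OF B(5) K start] and R = scan_range[OF B(5)]
  have "4 * wave_sum B x = real_of_int (4 * jump_sum B x - (\<Sum>(m, g)\<leftarrow>B. g))"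
  proof (rule wave_sum_eq[OF _ x])
    fix m g assume "(m, g) \<in> set B"
    from R(2)[OF this] show "base \<le> m \<and> m < 2 * base" by linarith
  qed
  moreover have "wave (x / real_of_int base) = 3 / 4"
    using wave_eq[of base x] x by simp
  ultimately have "4 * wave_sum A x = real_of_int (3 * g + 4 * jump_sum B x - (\<Sum>(m, g)\<leftarrow>B. g))"
    by (simp add: B(1))
  also have "3 * g + 4 * jump_sum B x - (\<Sum>(m, g)\<leftarrow>B. g) = z + 4 * g + 4 * jump_sum B x"
    using R(1) by linarith
  finally have eq: "4 * wave_sum A x = real_of_int (z + 4 * g + 4 * jump_sum B x)" .
  show "\<bar>4 * wave_sum A x\<bar> \<le> K * (19 * x - 7 * base)" using S by (simp only: eq)
  show "4 * wave_sum A x \<ge> l" if "x = real_of_int base"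
  proof -
    have "jump_sum B x = 0"
    proof (rule jump_sum_eq_0)
      fix m g assume "(m, g) \<in> set B"
      hence "base + 1 \<le> m" using R(2) by blast
      thus "x < real_of_int m" using that by linarith
    qed
    hence "4 * wave_sum A x = real_of_int (z + 4 * g)" using eq by simp
    thus ?thesis using B(3) by (simp only: of_int_le_iff)
  qed
qed

lemma wave_powi:
  assumes "x > 0" shows "wave (2 powi k * x) = (- 3) powi k * wave x"
proof -
  have "2 powi k * x = 2 powr k * x" by (simp add: powr_real_of_int')
  hence "\<lfloor>log 2 (2 powi k * x)\<rfloor> = \<lfloor>log 2 x\<rfloor> + k"
    using assms by (simp add: log_mult)
  thus ?thesis by (simp add: wave_def power_int_add)
qed

lemma wave_sum_powi:
  assumes "\<And>m g. (m, g) \<in> set A \<Longrightarrow> m > 0" "x > 0"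
  shows "wave_sum A (2 powi k * x) = (- 3) powi k * wave_sum A x"
  using assms(1)
proof (induction A)
  case (Cons e A)
  obtain m g where e: "e = (m, g)" by (cases e)
  have "m > 0" using Cons.prems[of m g] by (simp add: e)
  hence "wave (2 powi k * (x / m)) = (- 3) powi k * wave (x / m)"
    using assms(2) by (intro wave_powi) simp
  moreover have "wave_sum A (2 powi k * x) = (- 3) powi k * wave_sum A x"
    by (rule Cons.IH) (use Cons.prems in auto)
  ultimately show ?case by (simp add: e distrib_left mult.left_commute)
qed simp

lemma wave_check_pos:
  assumes "wave_check K z l A" "(m, g) \<in> set A" shows "m > 0"
proof -
  obtain g' B where B: "A = (base, g') # B" "scan K z (base + 1) (z + 4 * g') B"
    using assms(1) by (cases "(K, z, l, A)" rule: wave_check.cases) auto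
  show ?thesis using scan_range(2)[OF B(2), of m g] assms(2) B(1) by auto
qed

text \<open>
  Self-similarity extends the test on one octave to all \<open>x > 0\<close>: doubling \<open>x\<close> multiplies both the sum of
  waves, in absolute value, and \<open>x powr alpha\<close> by \<open>3\<close>. The constant comes from
  \<open>12 * K * base / (4 * base powr alpha)\<close> with \<open>base powr alpha = 3 ^ 24\<close>.
\<close>

lemma wave_sum_bound:
  assumes A: "wave_check K z l A" and x: "x > 0"
  shows "\<bar>wave_sum A x\<bar> \<le> 3 * real_of_int K * (2 / 3) ^ 24 * x powr alpha"
proof -
  define k where "k = \<lfloor>log 2 x\<rfloor> - 24"
  define y where "y = x / 2 powi k"
  have xy: "x = 2 powi k * y" by (simp add: y_def)
  have y0: "y > 0" using x by (simp add: y_def)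
  have logy: "\<lfloor>log 2 y\<rfloor> = 24"
  proof -
    have "log 2 x = k + log 2 y"
      using y0 by (subst xy) (simp add: log_mult flip: powr_real_of_int')
    hence "\<lfloor>log 2 x\<rfloor> = k + \<lfloor>log 2 y\<rfloor>" by simp
    thus ?thesis by (simp add: k_def)
  qed
  hence y: "real_of_int base \<le> y" "y < real_of_int (2 * base)"
    using y0 floor_log_eq_powr_iff[of y 2 24] by (simp_all add: powr_numeral)
  have K: "K \<ge> 0"
  proof -
    have "0 \<le> \<bar>4 * wave_sum A y\<bar>" by simp
    also have "\<dots> \<le> K * (19 * y - 7 * base)" using wave_check_period(1)[OF A y] .
    finally show ?thesis using y by (simp add: zero_le_mult_iff)
  qed
  have "19 * y - 7 * real_of_int base = 12 * base * (1 + 19/12 * (y / base - 1))" by (simp add: field_simps)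
  also have "\<dots> \<le> 12 * base * (y / base) powr (19/12)"
    using y by (intro mult_left_mono powr_ge_tangent) auto
  also have "\<dots> \<le> 12 * base * (y / base) powr alpha"
    using y alpha_gt by (intro mult_left_mono powr_mono) auto
  also have "(y / base) powr alpha = y powr alpha / 3 ^ 24"
  proof -
    have "(2::real) ^ 24 = 2 powr 24" by simp
    hence "real_of_int base powr alpha = (2 powr 24) powr alpha" by simp
    also have "\<dots> = (2 powr alpha) powr 24" by (simp only: powr_powr mult.commute)
    also have "\<dots> = 3 ^ 24" by simp
    finally show ?thesis using y0 by (simp add: powr_divide)
  qed
  finally have "19 * y - 7 * base \<le> 12 * base * (y powr alpha / 3 ^ 24)" by simp
  hence "K * (19 * y - 7 * base) \<le> K * (12 * base * (y powr alpha / 3 ^ 24))"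
    using K by (intro mult_left_mono) auto
  with wave_check_period(1)[OF A y]
  have "4 * \<bar>wave_sum A y\<bar> \<le> K * (12 * base * (y powr alpha / 3 ^ 24))" by (simp add: abs_mult)
  hence wy: "\<bar>wave_sum A y\<bar> \<le> 3 * real_of_int K * (2 / 3) ^ 24 * y powr alpha" by (simp add: power_divide)
  have "\<bar>wave_sum A x\<bar> = 3 powi k * \<bar>wave_sum A y\<bar>"
    by (subst xy, subst wave_sum_powi) (use wave_check_pos[OF A] y0 in \<open>auto simp: abs_mult power_int_abs\<close>)
  also have "\<dots> \<le> 3 powi k * (3 * real_of_int K * (2 / 3) ^ 24 * y powr alpha)"
    using wy by (intro mult_left_mono) auto
  also have "3 powi k = (2 powi k) powr alpha"
  proof -
    have "(2 powi k) powr alpha = (2 powr k) powr alpha" by (simp add: powr_real_of_int')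
    also have "\<dots> = (2 powr alpha) powr k" by (simp only: powr_powr mult.commute)
    finally show ?thesis by (simp add: powr_real_of_int')
  qed
  also have "(2 powi k) powr alpha * (3 * real_of_int K * (2 / 3) ^ 24 * y powr alpha) = 3 * real_of_int K * (2 / 3) ^ 24 * x powr alpha"
    by (subst xy) (simp add: powr_mult y0 less_imp_le)
  finally show ?thesis .
qed

section \<open>Certified bounds\<close>

text \<open>
  Bottom-up merge sort by the first component. Only the invariance of the sum of waves has to be proved
  about it, since the scan itself tests sortedness; ten rounds merge up to 1024 jumps.
\<close>

fun merge :: "jump list \<Rightarrow> jump list \<Rightarrow> jump list" where
  "merge [] B = B"
| "merge A [] = A"
| "merge (a # A) (b # B) = (if fst a \<le> fst b then a # merge A (b # B) else b # merge (a # A) B)"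

fun merge_pairs :: "jump list list \<Rightarrow> jump list list" where
  "merge_pairs (A # B # Cs) = merge A B # merge_pairs Cs"
| "merge_pairs As = As"

fun merge_all :: "nat \<Rightarrow> jump list list \<Rightarrow> jump list" where
  "merge_all (Suc k) (A # B # Cs) = merge_all k (merge_pairs (A # B # Cs))"
| "merge_all k As = concat As"

lemma wave_sum_merge: "wave_sum (merge A B) x = wave_sum A x + wave_sum B x"
  by (induction A B rule: merge.induct) auto

lemma wave_sum_merge_pairs: "wave_sum (concat (merge_pairs As)) x = wave_sum (concat As) x"
  by (induction As rule: merge_pairs.induct) (auto simp: wave_sum_merge)

lemma wave_sum_merge_all: "wave_sum (merge_all k As) x = wave_sum (concat As) x"
proof (induction k As rule: merge_all.induct)
  case (1 k A B Cs)
  show ?case by (simp only: merge_all.simps 1 wave_sum_merge_pairs)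
qed auto

definition sort_jumps :: "jump list \<Rightarrow> jump list" where
  "sort_jumps A = merge_all 10 (map (\<lambda>e. [e]) A)"

lemma wave_sum_sort_jumps: "wave_sum (sort_jumps A) = wave_sum A"
  by (rule ext) (simp add: sort_jumps_def wave_sum_merge_all)

text \<open>
  The parameters are a pruning threshold \<open>th\<close>, the slope \<open>K\<close> of the linear bound, the value \<open>z\<close> at which the
  step function starts, a lower bound \<open>l\<close> at the first jump, and a bound \<open>e\<close> for the discarded part. They are
  found by running the expansion once; the test only confirms them.
\<close>

definition certified :: "entry list \<Rightarrow> int \<Rightarrow> int \<Rightarrow> int \<Rightarrow> int \<Rightarrow> int \<Rightarrow> bool" where
  "certified ps th K z l e \<longleftrightarrow> (case expand 64 (th * 2 ^ 20) ps 1 1 (2 ^ 20) of (A, a) \<Rightarrow>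
     a \<le> e * 2 ^ 20 \<and> wave_check K z l (sort_jumps A))"

lemma certifiedE:
  assumes "certified ps th K z l e" "valid ps"
  obtains A where "wave_check K z l A"
    "dominated (\<lambda>x. smooth_sum (smooth_primes ps) x - wave_sum A x) (e / 2 ^ 20)"
proof -
  obtain A a where A: "expand 64 (th * 2 ^ 20) ps 1 1 (2 ^ 20) = (A, a)"
    by (cases "expand 64 (th * 2 ^ 20) ps 1 1 (2 ^ 20)")
  with assms(1) have a: "a \<le> e * 2 ^ 20" and c: "wave_check K z l (sort_jumps A)"
    by (simp_all add: certified_def)
  have "dominated (\<lambda>x. of_int 1 * smooth_sum (smooth_primes ps) (x / of_int 1) - wave_sum A x) (a / 2 ^ 40)"
    by (rule dominated_expand[OF assms(2) _ _ A]) auto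
  moreover have "real_of_int a / 2 ^ 40 \<le> e / 2 ^ 20"
  proof -
    have "real_of_int a \<le> real_of_int (e * 2 ^ 20)" using a by (simp only: of_int_le_iff)
    thus ?thesis by simp
  qed
  ultimately have "dominated (\<lambda>x. smooth_sum (smooth_primes ps) x - wave_sum A x) (e / 2 ^ 20)"
    using dominated_mono by fastforce
  with c show ?thesis by (intro that[of "sort_jumps A"]) (simp_all add: wave_sum_sort_jumps)
qed

lemma certified_dominated:
  assumes "certified ps th K z l e" "valid ps"
  shows "dominated (smooth_sum (smooth_primes ps)) (e / 2 ^ 20 + 3 * real_of_int K * (2 / 3) ^ 24)"
proof -
  obtain A where A: "wave_check K z l A"
    "dominated (\<lambda>x. smooth_sum (smooth_primes ps) x - wave_sum A x) (e / 2 ^ 20)"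
    using certifiedE[OF assms] .
  have "dominated (wave_sum A) (3 * real_of_int K * (2 / 3) ^ 24)"
    unfolding dominated_def by (intro exI[of _ 0]) (use wave_sum_bound[OF A(1)] in simp)
  from dominated_add[OF A(2) this] show ?thesis by simp
qed

text \<open>
  The factor \<open>1 / (1 - v)\<close> paid for each prime ignores all cancellation and soon becomes too
  large. Evaluating the step function restores a bound close to the true one, which in turn makes the pruning of
  the next, larger tree efficient.
\<close>

lemma valid_improve:
  assumes "certified ((p, v, c) # ps) th K z l e" "valid ((p, v, c) # ps)"
    and "e * 3 ^ 24 + 3 * K * 2 ^ 44 \<le> c' * 3 ^ 24"
  shows "valid ((p, v, c') # ps)"
proof -
  have "real_of_int (e * 3 ^ 24 + 3 * K * 2 ^ 44) \<le> real_of_int (c' * 3 ^ 24)"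
    using assms(3) by (simp only: of_int_le_iff)
  hence "e / 2 ^ 20 + 3 * real_of_int K * (2 / 3) ^ 24 \<le> c' / 2 ^ 20" by (simp add: field_simps)
  from dominated_mono[OF certified_dominated[OF assms(1,2)] this] assms(2) show ?thesis by simp
qed

fun extend :: "(int \<times> int) list \<Rightarrow> int \<Rightarrow> entry list \<Rightarrow> entry list" where
  "extend [] c ps = ps"
| "extend ((p, v) # qs) c ps = (let c' = c * 2 ^ 20 div (2 ^ 20 - v) + 1 in extend qs c' ((p, v, c') # ps))"

text \<open>
  The last inequality is \<open>(2 / p) powr (19/12) \<le> v / 2 ^ 20\<close>, raised to the power \<open>12\<close> and cleared of
  denominators.
\<close>

definition prime_weight :: "int \<times> int \<Rightarrow> bool" where
  "prime_weight = (\<lambda>(p, v). p > 2 \<and> prime p \<and> 0 < v \<and> v < 2 ^ 20 \<and> 2 ^ 259 \<le> v ^ 12 * p ^ 19)"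

lemma prime_weight_bound:
  assumes "prime_weight (p, v)" shows "(2 / p) powr alpha \<le> v / 2 ^ 20"
proof -
  have p: "p > 2" "v > 0" "2 ^ 259 \<le> v ^ 12 * p ^ 19" using assms by (auto simp: prime_weight_def)
  have "(2 / p) powr alpha \<le> (2 / p) powr (19/12)"
    using p(1) alpha_gt by (intro powr_mono') auto
  also have "\<dots> \<le> v / 2 ^ 20"
  proof (rule power_le_imp_le_base[of _ 11])
    have "((2 / real_of_int p) powr (19/12)) ^ Suc 11 = (2 / p) powr 19"
      by (simp add: powr_powr flip: powr_realpow powr_numeral)
    also have "\<dots> = 2 ^ 19 / p ^ 19" using p(1) by (simp add: power_divide)
    also have "\<dots> \<le> (v / 2 ^ 20) ^ Suc 11"
    proof -
      have "real_of_int (2 ^ 259) \<le> real_of_int (v ^ 12 * p ^ 19)" using p(3) by (simp only: of_int_le_iff)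
      thus ?thesis using p(1) by (simp add: field_simps power_divide)
    qed
    finally show "((2 / real_of_int p) powr (19/12)) ^ Suc 11 \<le> (v / 2 ^ 20) ^ Suc 11" .
  qed (use p in simp)
  finally show ?thesis .
qed

lemma valid_extend:
  assumes "valid ps" "dominated (smooth_sum (smooth_primes ps)) (c / 2 ^ 20)"
    and "list_all prime_weight qs" "distinct (map fst qs)" "\<forall>q\<in>set qs. nat (fst q) \<notin> smooth_primes ps"
  shows "valid (extend qs c ps)"
  using assms
proof (induction qs c ps rule: extend.induct)
  case (2 p v qs c ps)
  define c' where "c' = c * 2 ^ 20 div (2 ^ 20 - v) + 1"
  have pw: "prime_weight (p, v)" using 2(4) by simp
  hence p: "p > 2" "v < 2 ^ 20" "v > 0" "prime p" by (simp_all add: prime_weight_def)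
  have pn: "prime (nat p)" "nat p \<notin> smooth_primes ps"
    using p(4) 2(6) by (simp_all only: prime_int_nat_transfer list.set ball_simps fst_conv simp_thms)
  have w: "(2 / p) powr alpha \<le> v / 2 ^ 20" by (rule prime_weight_bound[OF pw])
  obtain d where d: "d \<ge> 0" "\<And>x. x > 0 \<Longrightarrow> \<bar>smooth_sum (smooth_primes ps) x\<bar> \<le> c / 2 ^ 20 * x powr alpha + d * x powr (3/2)"
    using 2(3) unfolding dominated_def by blast
  have v1: "real_of_int v / 2 ^ 20 < 1"
  proof -
    have "real_of_int v < real_of_int (2 ^ 20)" using p(2) by (simp only: of_int_less_iff)
    thus ?thesis by simp
  qed
  \<comment> \<open>The ratio of the geometric series for the term of exponent \<open>3/2\<close>.\<close>
  define u where "u = 3 * real (nat p) powr (- 3/2)"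
  have u: "u < 1" unfolding u_def by (rule three_powr_minus_three_halves) (use p in linarith)
  have "\<bar>smooth_sum (insert (nat p) (smooth_primes ps)) x\<bar>
      \<le> c / 2 ^ 20 / (1 - v / 2 ^ 20) * x powr alpha + d / (1 - u) * x powr (3/2)" if "x > 0" for x
    by (rule smooth_sum_insert_bound[OF pn d(2) _ v1 _ u dominated_nonneg[OF 2(3)] d(1) that])
       (use w p(1) in \<open>simp_all add: u_def\<close>)
  hence "dominated (smooth_sum (insert (nat p) (smooth_primes ps))) (c / 2 ^ 20 / (1 - v / 2 ^ 20))"
    unfolding dominated_def using d(1) u by (intro exI[of _ "d / (1 - u)"]) auto
  moreover have "c / 2 ^ 20 / (1 - v / 2 ^ 20) \<le> c' / 2 ^ 20"
  proof -
    have "c * 2 ^ 20 \<le> c' * (2 ^ 20 - v)"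
      using p(2) unfolding c'_def by (simp add: distrib_right) (smt (verit) div_mult_mod_eq pos_mod_bound)
    hence "real_of_int (c * 2 ^ 20) \<le> real_of_int (c' * (2 ^ 20 - v))" by (simp only: of_int_le_iff)
    thus ?thesis using v1 by (simp add: field_simps)
  qed
  ultimately have D: "dominated (smooth_sum (insert (nat p) (smooth_primes ps))) (c' / 2 ^ 20)"
    by (rule dominated_mono)
  have fresh: "nat (fst q) \<noteq> nat p" if "q \<in> set qs" for q
  proof -
    have "fst q \<noteq> p" "fst q > 2" using 2(4,5) that by (auto simp: list_all_iff prime_weight_def)
    thus ?thesis using p(1) by (simp add: eq_nat_nat_iff)
  qed
  have "valid (extend qs c' ((p, v, c') # ps))"
    using 2(1)[OF c'_def] 2(2,4,5,6) p pn w D fresh by (simp add: c'_def)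
  thus ?case by (simp add: c'_def Let_def)
qed simp

section \<open>Evaluation for the primes below 200\<close>

text \<open>
  Each odd prime below 200 with the least integer \<open>v\<close> admissible as its weight. The remaining primes exceed
  \<open>198 = 6 * 33\<close> and have total weight below \<open>2/25\<close>.
\<close>

definition primes_3_to_199 :: "(int \<times> int) list" where
  "primes_3_to_199 = [(3, 551809), (5, 245770), (7, 144265), (11, 70528), (13, 54137), (17, 35402),
    (19, 29686), (23, 21937), (29, 15198), (31, 13675), (37, 10334), (41, 8784),
    (43, 8146), (47, 7076), (53, 5850), (59, 4937), (61, 4683), (67, 4036),
    (71, 3682), (73, 3524), (79, 3110), (83, 2876), (89, 2575), (97, 2247),
    (101, 2108), (103, 2043), (107, 1924), (109, 1868), (113, 1765), (127, 1467),
    (131, 1396), (137, 1301), (139, 1271), (149, 1139), (151, 1115), (157, 1049),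
    (163, 988), (167, 951), (173, 899), (179, 852), (181, 837), (191, 769),
    (193, 756), (197, 732), (199, 721)]"

lemma list_all_prime_weight: "list_all prime_weight primes_3_to_199"
  by code_simp

lemma primes_below_200:
  assumes "prime q" "q < 200" shows "q = 2 \<or> int q \<in> set (map fst primes_3_to_199)"
proof -
  have "list_all (\<lambda>n. n = 2 \<or> n \<in> set (map fst primes_3_to_199) \<or> \<not> prime n) [2..199::int]"
    by code_simp
  hence "\<forall>n\<in>{2..199}. n = 2 \<or> n \<in> set (map fst primes_3_to_199) \<or> \<not> prime n"
    unfolding list_all_iff set_upto .
  moreover have "int q \<in> {2..199}" using prime_ge_2_nat[OF assms(1)] assms(2) by simp
  ultimately have "int q = 2 \<or> int q \<in> set (map fst primes_3_to_199) \<or> \<not> prime (int q)" by (rule bspec)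
  moreover have "prime (int q)" using assms(1) by simp
  ultimately show ?thesis by simp
qed

text \<open>
  Without the prime \<open>3\<close> the bound is \<open>3/4\<close>, that of a single wave, which is \<open>786432\<close> over
  \<open>2 ^ 20\<close>; including \<open>3\<close> naively more than doubles it to \<open>1.58\<close>, and a tree with 11 jumps reduces it to
  \<open>0.7634\<close>.
\<close>

lemma valid_3: "valid [(3, 551809, 800466)]"
proof -
  have "dominated (smooth_sum (smooth_primes [])) (786432 / 2 ^ 20)"
  proof -
    have "dominated (\<lambda>x. smooth_sum {2} x - wave x) 0"
      unfolding dominated_def by (intro exI[of _ "3/4"]) (use smooth_sum_2 in auto)
    moreover have "dominated wave (3/4)"
      unfolding dominated_def by (intro exI[of _ 0]) (use wave_bound in auto)
    ultimately show ?thesis using dominated_add[of "\<lambda>x. smooth_sum {2} x - wave x" 0 wave "3/4"] by simp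
  qed
  hence "valid (extend [(3, 551809)] 786432 [])"
    by (intro valid_extend) (use list_all_prime_weight in \<open>simp_all add: primes_3_to_199_def\<close>)
  moreover have "extend [(3, 551809)] 786432 [] = [(3, 551809, 1660002)]" by simp
  ultimately have v: "valid [(3, 551809, 1660002)]" by (simp only:)
  have "certified [(3, 551809, 1660002)] 2000 4276 (- 433523527191) 0 1425"
    by code_simp
  thus ?thesis by (rule valid_improve[OF _ v]) simp
qed

lemma dominated_head: "valid ((p, v, c) # ps) \<Longrightarrow> dominated (smooth_sum (smooth_primes ((p, v, c) # ps))) (c / 2 ^ 20)"
  by (simp only: valid.simps)

text \<open>
  In the same way the bound for the primes up to \<open>7\<close> drops from \<open>1.16\<close> to \<open>0.826\<close>.
\<close>

lemma valid_7: "valid [(7, 144265, 865421), (5, 245770, 1045520), (3, 551809, 800466)]"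
proof -
  have "valid (extend [(5, 245770), (7, 144265)] 800466 [(3, 551809, 800466)])"
    by (rule valid_extend[OF valid_3 dominated_head[OF valid_3]])
       (use list_all_prime_weight in \<open>simp_all add: primes_3_to_199_def\<close>)
  moreover have "extend [(5, 245770), (7, 144265)] 800466 [(3, 551809, 800466)]
      = [(7, 144265, 1212313), (5, 245770, 1045520), (3, 551809, 800466)]" by simp
  ultimately have v: "valid [(7, 144265, 1212313), (5, 245770, 1045520), (3, 551809, 800466)]" by (simp only:)
  have "certified [(7, 144265, 1212313), (5, 245770, 1045520), (3, 551809, 800466)] 1000
      4567 (- 210369325527) 0 12002"
    by code_simp
  thus ?thesis by (rule valid_improve[OF _ v]) simp
qed

definition entries_3_to_199 :: "entry list" where
  "entries_3_to_199 = extend (drop 3 primes_3_to_199) 865421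
     [(7, 144265, 865421), (5, 245770, 1045520), (3, 551809, 800466)]"

lemma valid_entries: "valid entries_3_to_199"
  unfolding entries_3_to_199_def
proof (rule valid_extend[OF valid_7 dominated_head[OF valid_7]])
  show "list_all prime_weight (drop 3 primes_3_to_199)"
    using list_all_prime_weight by (auto simp: list_all_iff dest: in_set_dropD)
  show "distinct (map fst (drop 3 primes_3_to_199))"
    by (simp add: primes_3_to_199_def)
  show "\<forall>q\<in>set (drop 3 primes_3_to_199). nat (fst q) \<notin> smooth_primes [(7, 144265, 865421), (5, 245770, 1045520), (3, 551809, 800466)]"
    by (simp add: primes_3_to_199_def)
qed

lemma smooth_primes_extend: "smooth_primes (extend qs c ps) = (\<lambda>q. nat (fst q)) ` set qs \<union> smooth_primes ps"
  by (induction qs c ps rule: extend.induct) (auto simp: Let_def)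

lemma smooth_primes_entries: "smooth_primes entries_3_to_199 = {q. prime q \<and> q < 200}"
proof -
  have "set primes_3_to_199 = set (take 3 primes_3_to_199) \<union> set (drop 3 primes_3_to_199)"
    by (metis append_take_drop_id set_append)
  hence eq: "smooth_primes entries_3_to_199 = insert 2 ((\<lambda>q. nat (fst q)) ` set primes_3_to_199)"
    by (simp add: entries_3_to_199_def smooth_primes_extend) (auto simp: primes_3_to_199_def)
  have le: "nat p < 200 \<and> prime (nat p)" if "(p, v) \<in> set primes_3_to_199" for p v
  proof -
    have "prime p" using list_all_prime_weight that by (auto simp: list_all_iff prime_weight_def)
    hence "prime (nat p)" by (simp only: prime_int_nat_transfer)
    moreover have "list_all (\<lambda>e. fst e < 200) primes_3_to_199" by (simp add: primes_3_to_199_def)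
    hence "p < 200" using that by (auto simp: list_all_iff)
    ultimately show ?thesis by simp
  qed
  have ge: "q = 2 \<or> q \<in> (\<lambda>q. nat (fst q)) ` set primes_3_to_199" if q: "prime q" "q < 200" for q
  proof (cases "q = 2")
    case False
    then obtain e where "e \<in> set primes_3_to_199" "int q = fst e"
      using primes_below_200[OF q] by auto
    thus ?thesis by (intro disjI2 image_eqI[of _ _ e]) (simp_all flip: \<open>int q = fst e\<close>)
  qed simp
  show ?thesis
  proof (intro equalityI subsetI)
    fix q assume "q \<in> smooth_primes entries_3_to_199"
    then consider "q = 2" | p v where "(p, v) \<in> set primes_3_to_199" "q = nat p"
      unfolding eq by force
    thus "q \<in> {q. prime q \<and> q < 200}" by cases (use le in auto)
  next
    fix q :: nat assume "q \<in> {q. prime q \<and> q < 200}"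
    thus "q \<in> smooth_primes entries_3_to_199" unfolding eq using ge[of q] by simp
  qed
qed

text \<open>
  The decisive evaluation. The tree has 686 jumps. Relative to \<open>x powr alpha\<close>, the absolute value of their sum
  is at most \<open>0.8129\<close> everywhere and at least \<open>0.8127\<close> at the powers of \<open>2\<close>, while the discarded branches amount
  to at most \<open>0.0701\<close>.
\<close>

lemma certified_entries:
  "certified entries_3_to_199 170 4561 (- 211531586994) 918186558930 73491"
  by code_simp

section \<open>The primes above 199 and the limit superior\<close>

lemma W3_eq_smooth_sum:
  assumes "\<And>q. prime q \<Longrightarrow> real q \<le> x \<Longrightarrow> q \<in> P"
  shows "real_of_int (W3 x) = smooth_sum P x"
proof -
  have "prime_factors n \<subseteq> P" if "0 < n" "real n \<le> x" for n
  proof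
    fix q assume "q \<in> prime_factors n"
    hence "prime q" "q \<le> n" using that by (auto simp: in_prime_factors_iff intro: dvd_imp_le)
    thus "q \<in> P" using assms[of q] that by linarith
  qed
  hence "{n. 0 < n \<and> real n \<le> x} = {n. 0 < n \<and> real n \<le> x \<and> prime_factors n \<subseteq> P}" by blast
  thus ?thesis by (simp add: W3_def smooth_sum_def)
qed

lemma sum_weight_bound:
  assumes "finite Q" and Q: "\<And>q. q \<in> Q \<Longrightarrow> prime q \<and> q > 198"
  shows "(\<Sum>q\<in>Q. (2 / real q) powr alpha) \<le> 2 / 25"
proof -
  have "(\<Sum>q\<in>Q. (2 / real q) powr alpha) \<le> (\<Sum>q\<in>Q. 2 powr (19/12) * real q powr (- (19/12)))"
  proof (rule sum_mono)
    fix q assume "q \<in> Q"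
    hence q: "q > 198" using Q by blast
    have "(2 / real q) powr alpha \<le> (2 / real q) powr (19/12)"
      using q alpha_gt by (intro powr_mono') auto
    thus "(2 / real q) powr alpha \<le> 2 powr (19/12) * real q powr (- (19/12))"
      by (simp add: powr_divide powr_minus_divide)
  qed
  also have "\<dots> = 2 powr (19/12) * (\<Sum>q\<in>Q. real q powr (- (19/12)))" by (simp add: sum_distrib_left)
  also have "\<dots> \<le> 2 powr (19/12) * (2 * 6 powr (- (19/12)) * (real 33 powr (- (19/12)) + real 33 powr (1 - 19/12) / (19/12 - 1)))"
    using assms by (intro mult_left_mono sum_prime_powr_tail) auto
  also have "\<dots> = 8 / 7 * (1 + 7 / 396) * 99 powr (- (7/12))"
  proof -
    have a: "(33::real) powr (- (19/12)) = 33 powr (- (7/12)) / 33"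
      using powr_diff[of "33::real" "- (7/12)" 1] by simp
    have b: "(2::real) powr (19/12) * 6 powr (- (19/12)) = 3 powr (- (7/12)) / 3"
    proof -
      have "(6::real) powr (- (19/12)) = 2 powr (- (19/12)) * 3 powr (- (19/12))"
        using powr_mult[of 2 3 "- (19/12)"] by simp
      thus ?thesis using powr_diff[of "3::real" "- (7/12)" 1] by (simp add: powr_minus_divide)
    qed
    have c: "(99::real) powr (- (7/12)) = 3 powr (- (7/12)) * 33 powr (- (7/12))"
      using powr_mult[of 3 33 "- (7/12)"] by simp
    have "(2::real) powr (19/12) * (2 * 6 powr (- (19/12)) * (real 33 powr (- (19/12)) + real 33 powr (1 - 19/12) / (19/12 - 1)))
        = (2 powr (19/12) * 6 powr (- (19/12))) * (2 * (33 powr (- (19/12)) + 33 powr (- (7/12)) * (12 / 7)))"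
      by simp
    also have "\<dots> = 8 / 7 * (1 + 7 / 396) * (3 powr (- (7/12)) * 33 powr (- (7/12)))"
      unfolding a b by (simp add: field_simps)
    finally show ?thesis by (simp only: c)
  qed
  also have "99 powr (- (7/12)) \<le> (20 / 291 :: real)"
  proof -
    \<comment> \<open>A rational number just below \<open>99 powr (7/12) = 14.59...\<close>, checked through twelfth powers.\<close>
    have "(291 / 20 :: real) \<le> 99 powr (7/12)"
    proof (rule power_le_imp_le_base[of _ 11])
      have "((99::real) powr (7/12)) ^ Suc 11 = 99 ^ 7"
        by (simp add: powr_powr flip: powr_realpow powr_numeral)
      thus "(291 / 20 :: real) ^ Suc 11 \<le> (99 powr (7/12)) ^ Suc 11" by (simp add: power_divide)
    qed simp
    thus ?thesis by (simp add: powr_minus_divide field_simps)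
  qed
  finally show ?thesis by simp
qed

lemma sum_three_halves_bound:
  assumes "finite Q" and Q: "\<And>q. q \<in> Q \<Longrightarrow> prime q \<and> q > 198"
  shows "(\<Sum>q\<in>Q. 3 * real q powr (- 3/2)) \<le> 2 / 3"
proof -
  have "(\<Sum>q\<in>Q. real q powr (- (3/2))) \<le> 2 * 6 powr (- (3/2)) * (real 33 powr (- (3/2)) + real 33 powr (1 - 3/2) / (3/2 - 1))"
    using assms by (intro sum_prime_powr_tail) auto
  also have "\<dots> \<le> 2 * 6 powr (- 1) * (16 powr (- 1) + 16 powr (- (1/2)) / (1/2))"
  proof -
    have "(6::real) powr (- (3/2)) \<le> 6 powr (- 1)" by (intro powr_mono) auto
    moreover have "(33::real) powr (- (3/2)) \<le> 33 powr (- 1)" by (intro powr_mono) auto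
    moreover have "(33::real) powr (- 1) \<le> 16 powr (- 1)" by (intro powr_mono2') auto
    moreover have "(33::real) powr (- (1/2)) \<le> 16 powr (- (1/2))" by (intro powr_mono2') auto
    ultimately have "(33::real) powr (- (3/2)) + 33 powr (- (1/2)) / (1/2) \<le> 16 powr (- 1) + 16 powr (- (1/2)) / (1/2)"
      "(6::real) powr (- (3/2)) \<le> 6 powr (- 1)" by simp_all
    thus ?thesis by (intro mult_mono) auto
  qed
  finally have "(\<Sum>q\<in>Q. real q powr (- (3/2))) \<le> 1/3 * (1/16 + 2 * (1/4))"
    by (simp add: powr_minus_divide powr_half_sqrt)
  thus ?thesis by (simp flip: sum_distrib_left)
qed

text \<open>
  For a given \<open>x\<close> only the primes up to \<open>x\<close> matter, so \<open>W3 x\<close> is the smooth sum over finitely many primes.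
  Those above \<open>199\<close> have total weight at most \<open>2/25\<close>, hence change the sum by at most
  \<open>(2/25) / (1 - 2/25) = 2/23\<close> of the bound \<open>c\<close>.
\<close>

lemma dominated_W3_diff:
  assumes "dominated (smooth_sum (smooth_primes entries_3_to_199)) c"
  shows "dominated (\<lambda>x. W3 x - smooth_sum (smooth_primes entries_3_to_199) x) (2 / 23 * c)"
proof -
  let ?P = "smooth_primes entries_3_to_199"
  obtain d where d: "d \<ge> 0" "\<And>x. x > 0 \<Longrightarrow> \<bar>smooth_sum ?P x\<bar> \<le> c * x powr alpha + d * x powr (3/2)"
    using assms unfolding dominated_def by blast
  have c: "c \<ge> 0" by (rule dominated_nonneg[OF assms])
  have "\<bar>W3 x - smooth_sum ?P x\<bar> \<le> 2 / 23 * c * x powr alpha + 2 * d * x powr (3/2)" if x: "x > 0" for x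
  proof -
    define Q where "Q = {q. 0 < q \<and> real q \<le> x \<and> prime q \<and> q \<notin> ?P}"
    have fin: "finite Q" unfolding Q_def by (rule finite_nat_le_real)
    have Q: "prime q" "q > 198" "q \<notin> ?P" if "q \<in> Q" for q
      using that by (auto simp: Q_def smooth_primes_entries)
    define \<sigma> where "\<sigma> = (\<Sum>q\<in>Q. (2 / real q) powr alpha)"
    define \<tau> where "\<tau> = (\<Sum>q\<in>Q. 3 * real q powr (- 3/2))"
    have s: "0 \<le> \<sigma>" "\<sigma> \<le> 2 / 25" "0 \<le> \<tau>" "\<tau> \<le> 2 / 3"
      using sum_weight_bound[OF fin] sum_three_halves_bound[OF fin] Q
      by (auto simp: \<sigma>_def \<tau>_def intro: sum_nonneg)
    have "\<bar>smooth_sum (?P \<union> Q) x - smooth_sum ?P x\<bar>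
        \<le> c * (\<sigma> / (1 - \<sigma>)) * x powr alpha + d * (\<tau> / (1 - \<tau>)) * x powr (3/2)"
      unfolding \<sigma>_def \<tau>_def
      by (rule smooth_sum_union_bound[OF fin _ d(2) c d(1) _ _ x]) (use Q s in \<open>auto simp: \<sigma>_def \<tau>_def\<close>)
    also have "\<dots> \<le> c * (2 / 23) * x powr alpha + d * 2 * x powr (3/2)"
    proof -
      have "\<sigma> / (1 - \<sigma>) \<le> 2 / 23" "\<tau> / (1 - \<tau>) \<le> 2" using s by (simp_all add: field_simps)
      thus ?thesis using c d(1) by (intro add_mono mult_right_mono mult_left_mono) auto
    qed
    also have "smooth_sum (?P \<union> Q) x = W3 x"
      by (rule W3_eq_smooth_sum[symmetric]) (auto simp: Q_def prime_gt_0_nat)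
    finally show ?thesis by (simp add: mult_ac)
  qed
  thus ?thesis unfolding dominated_def using d(1) by (intro exI[of _ "2 * d"]) auto
qed

lemma dominated_eventually:
  assumes "dominated F c" "c < b" shows "eventually (\<lambda>x. \<bar>F x\<bar> / x powr alpha < b) at_top"
proof -
  obtain d where d: "d \<ge> 0" "\<And>x. x > 0 \<Longrightarrow> \<bar>F x\<bar> \<le> c * x powr alpha + d * x powr (3/2)"
    using assms(1) unfolding dominated_def by blast
  have "eventually (\<lambda>x. d * x powr (3/2 - alpha) < b - c) at_top"
    using assms(2) by (intro powr_neg_eventually_less) auto
  thus ?thesis using eventually_gt_at_top[of "0::real"]
  proof eventually_elim
    case (elim x)
    have "\<bar>F x\<bar> / x powr alpha \<le> (c * x powr alpha + d * x powr (3/2)) / x powr alpha"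
      using d(2)[OF elim(2)] by (intro divide_right_mono) auto
    also have "\<dots> = c + d * x powr (3/2 - alpha)"
      using elim(2) by (simp add: add_divide_distrib powr_diff)
    finally show ?case using elim(1) by linarith
  qed
qed

theorem theorem1p6:
  shows "\<bar>s3 - ereal 0.813\<bar> \<le> ereal 0.158 \<and> s3 < 1"
proof -
  let ?P = "smooth_primes entries_3_to_199"
  let ?r = "\<lambda>x. \<bar>real_of_int (W3 x)\<bar> / x powr alpha"
  obtain A where A: "wave_check 4561 (- 211531586994) 918186558930 A"
    "dominated (\<lambda>x. smooth_sum ?P x - wave_sum A x) (real_of_int 73491 / 2 ^ 20)"
    using certifiedE[OF certified_entries valid_entries] .
  define c where "c = real_of_int 73491 / 2 ^ 20 + 3 * real_of_int 4561 * (2 / 3) ^ 24"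
  have P: "dominated (smooth_sum ?P) c"
    unfolding c_def by (rule certified_dominated[OF certified_entries valid_entries])
  have diff: "dominated (\<lambda>x. W3 x - smooth_sum ?P x) (2 / 23 * c)"
    by (rule dominated_W3_diff[OF P])
  have "dominated (\<lambda>x. (W3 x - smooth_sum ?P x) + smooth_sum ?P x) (2 / 23 * c + c)"
    by (rule dominated_add[OF diff P])
  hence "dominated (\<lambda>x. real_of_int (W3 x)) (2 / 23 * c + c)" by simp
  hence "eventually (\<lambda>x. ?r x < 971/1000) at_top"
    by (rule dominated_eventually) (simp add: c_def power_divide)
  hence "eventually (\<lambda>x. ereal (?r x) \<le> ereal (971/1000)) at_top" by (rule eventually_mono) simp
  hence upper: "s3 \<le> ereal (971/1000)" unfolding s3_def by (rule Limsup_bounded)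
  have lower: "ereal (131/200) \<le> s3"
  proof (rule ccontr)
    assume "\<not> ereal (131/200) \<le> s3"
    hence "Limsup at_top (\<lambda>x. ereal (?r x)) < ereal (131/200)" by (simp add: s3_def)
    from Limsup_lessD[OF this] have "eventually (\<lambda>x. ?r x < 131/200) at_top" by simp
    moreover have "dominated (\<lambda>x. (W3 x - smooth_sum ?P x) + (smooth_sum ?P x - wave_sum A x))
        (2 / 23 * c + real_of_int 73491 / 2 ^ 20)"
      by (rule dominated_add[OF diff A(2)])
    hence "dominated (\<lambda>x. W3 x - wave_sum A x) (2 / 23 * c + real_of_int 73491 / 2 ^ 20)" by simp
    hence "eventually (\<lambda>x. \<bar>W3 x - wave_sum A x\<bar> / x powr alpha < 3/20) at_top"
      by (rule dominated_eventually) (simp add: c_def power_divide)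
    ultimately have "eventually (\<lambda>x. ?r x < 131/200 \<and> \<bar>W3 x - wave_sum A x\<bar> / x powr alpha < 3/20) at_top"
      by (rule eventually_conj)
    then obtain N where N: "\<And>x. x \<ge> N \<Longrightarrow> ?r x < 131/200 \<and> \<bar>W3 x - wave_sum A x\<bar> / x powr alpha < 3/20"
      unfolding eventually_at_top_linorder by blast
    \<comment> \<open>Along the powers of \<open>2\<close>, the sum of waves attains the value recorded at the first jump.\<close>
    obtain k where "N < 2 ^ k" using real_arch_pow[of 2 N] by auto
    define x where "x = 2 ^ k * real_of_int base"
    have "(2::real) ^ k \<le> x" by (simp add: x_def)
    hence k: "?r x < 131/200" "\<bar>W3 x - wave_sum A x\<bar> / x powr alpha < 3/20"
      using N[of x] \<open>N < 2 ^ k\<close> by linarith+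
    have "x = 2 powr (real k + 24)" by (simp add: x_def powr_add powr_realpow)
    hence "x powr alpha = (2 powr alpha) powr (real k + 24)" by (simp only: powr_powr mult.commute)
    hence xa: "x powr alpha = 3 ^ k * 3 ^ 24" by (simp add: powr_add powr_realpow)
    have "wave_sum A x = (- 3) ^ k * wave_sum A (real_of_int base)"
      using wave_sum_powi[of A "real_of_int base" "int k"] wave_check_pos[OF A(1)]
      by (simp add: x_def power_int_def)
    hence "\<bar>wave_sum A x\<bar> = 3 ^ k * \<bar>wave_sum A (real_of_int base)\<bar>" by (simp add: abs_mult power_abs)
    moreover have "4 * wave_sum A (real_of_int base) \<ge> real_of_int 918186558930"
      using wave_check_period(2)[OF A(1), of "real_of_int base"] by simp
    ultimately have "\<bar>wave_sum A x\<bar> \<ge> 3 ^ k * (918186558930 / 4)" by simp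
    hence "\<bar>wave_sum A x\<bar> / x powr alpha \<ge> 3 ^ k * (918186558930 / 4) / (3 ^ k * 3 ^ 24)"
      unfolding xa by (intro divide_right_mono) auto
    hence "\<bar>wave_sum A x\<bar> / x powr alpha \<ge> 81/100" by simp
    moreover have "\<bar>wave_sum A x\<bar> / x powr alpha \<le> ?r x + \<bar>W3 x - wave_sum A x\<bar> / x powr alpha"
      unfolding add_divide_distrib[symmetric] by (intro divide_right_mono) auto
    ultimately show False using k by linarith
  qed
  have "- \<infinity> < s3" by (rule less_le_trans[OF _ lower]) simp
  moreover have "s3 < \<infinity>" by (rule le_less_trans[OF upper]) simp
  ultimately obtain r where r: "s3 = ereal r" by (cases s3) auto
  have "131/200 \<le> r" "r \<le> 971/1000" using lower upper by (simp_all add: r)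
  hence "\<bar>r - 813/1000\<bar> \<le> 79/500" "r < 1" by linarith+
  thus ?thesis by (simp add: r)
qed

end
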